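(* Let $M$ be $S$-measurable (with generalised measure $h$), let $d:S\to D$ be the corresponding dimension function and let $D_0=\{d(X):X\in\mathrm{Def}(M)\}$ be the set of dimensions taken by definable sets. Suppose that $D_0$ is well-ordered and identify it with the corresponding ordinal. Then (i) $D(X)\le d(X)$ for all definable sets $X$, where $D(X)$ denotes the $D$-rank of $X$; and (ii) $T=\mathrm{Th}(M)$ is supersimple.
   Context: Measuring semirings. An ordered semiring $S=(S,+,\cdot,0,1,<)$ satisfies: $(S,+,0)$ and $(S,\cdot,1)$ are commutative monoids; $\cdot$ distributes over $+$; $<$ is a total order with least element $0$; $x\le y\Rightarrow x+z\le y+z$; $x\le y\Rightarrow xz\le yz$; $0\cdot x=x\cdot 0=0$; $0<x,\ 0<y\Rightarrow 0<xy$; $0\ne1$. Write $a\sim b$ if $a\le b\le n\cdot a$ or $b\le a\le n\cdot b$ for some positive integer $n$; $\sim$ is an equivalence relation with convex classes, and $d:S\to D:=S/{\sim}$ is the quotient map onto the induced totally ordered set (not to be confused with $D$-rank). $S$ is a measuring semiring if in addition for all $x,y,z\in S$: if $x<y$ and $d(y)=d(z)$ then $x+z<y+z$. $S$-measurability. $\mathrm{Def}(M)$ is the collection of sets (in powers of $M$) definable in $M$ with parameters. For a measuring semiring $S$, an $L$-structure $M$ is $S$-measurable if there is $h:\mathrm{Def}(M)\to S$ such that: (1) $h(X)=|X|$ (i.e. $|X|\cdot1$) for finite $X$; (2) $h(X\cup Y)=h(X)+h(Y)$ for disjoint $X,Y\in\mathrm{Def}(M)$; (3) for each family $\{\phi(M^{|\bar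 x|};\bar b):\bar b\in M^{|\bar y|}\}$ given by an $L$-formula $\phi(\bar x;\bar y)$, the set $F$ of values of $h$ on the family is finite, and for each $f\in F$ the set $\{\bar b:h(\phi(M^{|\bar x|};\bar b))=f\}$ is $\emptyset$-definable; (4) if $p:X\to Y$ is a definable function and $f\in S$ is such that $h(p^{-1}(a))=f$ for all $a\in Y$, then $h(X)=f\cdot h(Y)$. Write $d(X):=d(h(X))$. $D$-rank is the usual ordinal-valued (or $\infty$) rank of simplicity theory, computed in a sufficiently saturated model: $D(X)\ge0$ iff $X\neq\emptyset$; $D(X)\ge\alpha+1$ iff there is a definable $Y\subseteq X$ which divides over a set of parameters over which $X$ is defined and has $D(Y)\ge\alpha$; and for limit $\lambda$, $D(X)\ge\lambda$ iff $D(X)\ge\alpha$ for all $\alpha<\lambda$. *)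

theory Defs
  imports Main "HOL-Library.Equipollence"
begin

section \<open>Measuring semirings\<close>

text \<open>The class \<^class>\<open>comm_semiring_1\<close> already provides both commutative monoids, distributivity,
  absorption by zero and \<open>0 \<noteq> 1\<close>.\<close>

class least_zero_ordered_semiring = comm_semiring_1 + linorder +
  assumes zero_least: "0 \<le> x"
    and add_right_monotone: "x \<le> y \<Longrightarrow> x + z \<le> y + z"
    and mult_right_monotone: "x \<le> y \<Longrightarrow> x * z \<le> y * z"
    and mult_positive: "0 < x \<Longrightarrow> 0 < y \<Longrightarrow> 0 < x * y"

definition (in least_zero_ordered_semiring) arch_equiv :: "'a \<Rightarrow> 'a \<Rightarrow> bool" where
  "arch_equiv a b \<longleftrightarrow>
     (\<exists>n>0. (a \<le> b \<and> b \<le> of_nat n * a) \<or> (b \<le> a \<and> a \<le> of_nat n * b))"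

lemma arch_mult_left_mono:
  "x \<le> y \<Longrightarrow> z * x \<le> z * (y :: 's::least_zero_ordered_semiring)"
  using mult_right_monotone[of x y z] by (simp add: mult.commute)

lemma arch_le_iff:
  "a \<le> b \<or> arch_equiv a b \<longleftrightarrow> (\<exists>n>0. a \<le> of_nat n * (b :: 's::least_zero_ordered_semiring))"
proof
  assume "a \<le> b \<or> arch_equiv a b"
  then show "\<exists>n>0. a \<le> of_nat n * b"
    unfolding arch_equiv_def by (metis mult_1 of_nat_1 zero_less_one)
next
  assume "\<exists>n>0. a \<le> of_nat n * b"
  then show "a \<le> b \<or> arch_equiv a b"
    unfolding arch_equiv_def by (meson linear)
qed

lemma arch_le_trans:
  fixes a b c :: "'s::least_zero_ordered_semiring"
  assumes "a \<le> b \<or> arch_equiv a b" "b \<le> c \<or> arch_equiv b c"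
  shows "a \<le> c \<or> arch_equiv a c"
proof -
  obtain n m where n: "n > 0" "a \<le> of_nat n * b" and m: "m > 0" "b \<le> of_nat m * c"
    using assms unfolding arch_le_iff by blast
  have "of_nat n * b \<le> of_nat n * (of_nat m * c)"
    using m(2) by (rule arch_mult_left_mono)
  then have "a \<le> of_nat (n * m) * c"
    using n(2) by (metis mult.assoc of_nat_mult order_trans)
  then show ?thesis
    unfolding arch_le_iff using n(1) m(1) by (metis nat_0_less_mult_iff)
qed

lemma arch_equiv_sym: "arch_equiv a b \<Longrightarrow> arch_equiv b a"
  unfolding arch_equiv_def by blast

lemma arch_equiv_iff:
  "arch_equiv a b \<longleftrightarrow> (a \<le> b \<or> arch_equiv a b) \<and> (b \<le> a \<or> arch_equiv b a)"
  for a b :: "'s::least_zero_ordered_semiring"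
proof -
  have "arch_equiv a a"
    unfolding arch_equiv_def by (intro exI[of _ 1]) simp
  then show ?thesis
    using arch_equiv_sym by (metis order_antisym)
qed

quotient_type (overloaded) 's sdim = "'s::least_zero_ordered_semiring" / arch_equiv
  morphisms rep_sdim sdim_of
proof (rule equivpI)
  show "reflp arch_equiv"
    unfolding reflp_def arch_equiv_def by (metis mult_1 of_nat_1 order_refl zero_less_one)
  show "symp arch_equiv"
    unfolding symp_def using arch_equiv_sym by blast
  show "transp arch_equiv"
    unfolding transp_def by (metis arch_equiv_iff arch_le_trans)
qed

instantiation sdim :: (least_zero_ordered_semiring) linorder
begin

lift_definition less_eq_sdim :: "'a sdim \<Rightarrow> 'a sdim \<Rightarrow> bool"
  is "\<lambda>a b. a \<le> b \<or> arch_equiv a b"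
  by (metis arch_equiv_iff arch_le_trans)

definition less_sdim :: "'a sdim \<Rightarrow> 'a sdim \<Rightarrow> bool" where
  "less_sdim x y \<longleftrightarrow> x \<le> y \<and> \<not> y \<le> x"

instance
proof
  fix x y z :: "'a sdim"
  show "x < y \<longleftrightarrow> x \<le> y \<and> \<not> y \<le> x" by (rule less_sdim_def)
  show "x \<le> x" by transfer simp
  show "x \<le> y \<Longrightarrow> y \<le> z \<Longrightarrow> x \<le> z" by transfer (rule arch_le_trans)
  show "x \<le> y \<Longrightarrow> y \<le> x \<Longrightarrow> x = y" by transfer (metis arch_equiv_iff)
  show "x \<le> y \<or> y \<le> x" by transfer (metis linear)
qed

end

text \<open>In the following axiom \<open>arch_equiv y z\<close> is the condition \<open>sdim_of y = sdim_of z\<close>; constants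
  on the quotient type are not available in a class specification.\<close>

class measuring_semiring = least_zero_ordered_semiring +
  assumes measuring_strict: "x < y \<Longrightarrow> arch_equiv y z \<Longrightarrow> x + z < y + z"

lemma measuring:
  "x < y \<Longrightarrow> sdim_of y = sdim_of z \<Longrightarrow> x + z < y + (z :: 's::measuring_semiring)"
  by (simp add: measuring_strict sdim.abs_eq_iff)


section \<open>First-order languages and structures\<close>

text \<open>A language is a set of function symbols and a set of relation symbols, each paired with its
  arity. A structure has as universe the whole of a (nonempty) type, and interprets symbols on
  argument lists; only the values on lists of the correct length matter.\<close>

record ('f, 'r) language =
  funs :: "('f \<times> nat) set"
  rels :: "('r \<times> nat) set"

record ('f, 'r, 'a) fo_structure =
  fun_interp :: "'f \<Rightarrow> 'a list \<Rightarrow> 'a"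
  rel_interp :: "'r \<Rightarrow> 'a list \<Rightarrow> bool"

datatype 'f tm = Var nat | Fun 'f "'f tm list"

datatype ('f, 'r) fm =
    Eq "'f tm" "'f tm"
  | Rel 'r "'f tm list"
  | Neg "('f, 'r) fm"
  | Conj "('f, 'r) fm" "('f, 'r) fm"
  | Exi nat "('f, 'r) fm"

primrec wf_tm :: "('f, 'r) language \<Rightarrow> 'f tm \<Rightarrow> bool" where
  "wf_tm L (Var i) \<longleftrightarrow> True"
| "wf_tm L (Fun f ts) \<longleftrightarrow> (f, length ts) \<in> funs L \<and> list_all (wf_tm L) ts"

primrec wf_fm :: "('f, 'r) language \<Rightarrow> ('f, 'r) fm \<Rightarrow> bool" where
  "wf_fm L (Eq s t) \<longleftrightarrow> wf_tm L s \<and> wf_tm L t"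
| "wf_fm L (Rel r ts) \<longleftrightarrow> (r, length ts) \<in> rels L \<and> list_all (wf_tm L) ts"
| "wf_fm L (Neg \<phi>) \<longleftrightarrow> wf_fm L \<phi>"
| "wf_fm L (Conj \<phi> \<psi>) \<longleftrightarrow> wf_fm L \<phi> \<and> wf_fm L \<psi>"
| "wf_fm L (Exi i \<phi>) \<longleftrightarrow> wf_fm L \<phi>"

primrec vars_tm :: "'f tm \<Rightarrow> nat set" where
  "vars_tm (Var i) = {i}"
| "vars_tm (Fun f ts) = \<Union> (set (map vars_tm ts))"

primrec free_vars :: "('f, 'r) fm \<Rightarrow> nat set" where
  "free_vars (Eq s t) = vars_tm s \<union> vars_tm t"
| "free_vars (Rel r ts) = \<Union> (set (map vars_tm ts))"
| "free_vars (Neg \<phi>) = free_vars \<phi>"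
| "free_vars (Conj \<phi> \<psi>) = free_vars \<phi> \<union> free_vars \<psi>"
| "free_vars (Exi i \<phi>) = free_vars \<phi> - {i}"

primrec eval_tm :: "('f, 'r, 'a) fo_structure \<Rightarrow> (nat \<Rightarrow> 'a) \<Rightarrow> 'f tm \<Rightarrow> 'a" where
  "eval_tm M e (Var i) = e i"
| "eval_tm M e (Fun f ts) = fun_interp M f (map (eval_tm M e) ts)"

primrec sat :: "('f, 'r, 'a) fo_structure \<Rightarrow> (nat \<Rightarrow> 'a) \<Rightarrow> ('f, 'r) fm \<Rightarrow> bool" where
  "sat M e (Eq s t) \<longleftrightarrow> eval_tm M e s = eval_tm M e t"
| "sat M e (Rel r ts) \<longleftrightarrow> rel_interp M r (map (eval_tm M e) ts)"
| "sat M e (Neg \<phi>) \<longleftrightarrow> \<not> sat M e \<phi>"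
| "sat M e (Conj \<phi> \<psi>) \<longleftrightarrow> sat M e \<phi> \<and> sat M e \<psi>"
| "sat M e (Exi i \<phi>) \<longleftrightarrow> (\<exists>a. sat M (e(i := a)) \<phi>)"

definition formula_in :: "('f, 'r) language \<Rightarrow> nat \<Rightarrow> ('f, 'r) fm \<Rightarrow> bool" where
  "formula_in L n \<phi> \<longleftrightarrow> wf_fm L \<phi> \<and> free_vars \<phi> \<subseteq> {..<n}"

text \<open>The tuple \<open>as\<close> is assigned to the variables \<open>0, \<dots>, length as - 1\<close>; the other variables get
  the unspecified value of \<open>as ! i\<close>, which is irrelevant for formulas satisfying
  \<open>formula_in L (length as)\<close>.\<close>

abbreviation sat_list :: "('f, 'r, 'a) fo_structure \<Rightarrow> 'a list \<Rightarrow> ('f, 'r) fm \<Rightarrow> bool" where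
  "sat_list M as \<phi> \<equiv> sat M (\<lambda>i. as ! i) \<phi>"

text \<open>\<open>solutions M n \<phi> b\<close> is the set \<open>\<phi>(M\<^sup>n; b)\<close>. The powers of the universe are the sets of lists
  of fixed length; a formula \<open>\<phi>(x; y)\<close> has the variables \<open>0, \<dots>, n - 1\<close> for \<open>x\<close> and
  \<open>n, \<dots>, n + length b - 1\<close> for \<open>y\<close>.\<close>

definition solutions :: "('f, 'r, 'a) fo_structure \<Rightarrow> nat \<Rightarrow> ('f, 'r) fm \<Rightarrow> 'a list \<Rightarrow> 'a list set" where
  "solutions M n \<phi> b = {a. length a = n \<and> sat_list M (a @ b) \<phi>}"

definition definable_over ::
  "('f, 'r) language \<Rightarrow> ('f, 'r, 'a) fo_structure \<Rightarrow> 'a set \<Rightarrow> nat \<Rightarrow> 'a list set \<Rightarrow> bool" where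
  "definable_over L M A n X \<longleftrightarrow>
     (\<exists>\<phi> b. set b \<subseteq> A \<and> formula_in L (n + length b) \<phi> \<and> X = solutions M n \<phi> b)"

abbreviation definable ::
  "('f, 'r) language \<Rightarrow> ('f, 'r, 'a) fo_structure \<Rightarrow> nat \<Rightarrow> 'a list set \<Rightarrow> bool" where
  "definable L M n X \<equiv> definable_over L M UNIV n X"

definition Th :: "('f, 'r) language \<Rightarrow> ('f, 'r, 'a) fo_structure \<Rightarrow> ('f, 'r) fm set" where
  "Th L M = {\<sigma>. formula_in L 0 \<sigma> \<and> sat_list M [] \<sigma>}"

definition models :: "('f, 'r, 'a) fo_structure \<Rightarrow> ('f, 'r) fm set \<Rightarrow> bool" where
  "models M T \<longleftrightarrow> (\<forall>\<sigma>\<in>T. sat_list M [] \<sigma>)"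

definition elementary_embedding ::
  "('f, 'r) language \<Rightarrow> ('f, 'r, 'a) fo_structure \<Rightarrow> ('f, 'r, 'u) fo_structure \<Rightarrow> ('a \<Rightarrow> 'u) \<Rightarrow> bool" where
  "elementary_embedding L M N j \<longleftrightarrow>
     (\<forall>\<phi> a. formula_in L (length a) \<phi> \<longrightarrow> (sat_list M a \<phi> \<longleftrightarrow> sat_list N (map j a) \<phi>))"


section \<open>Measurable structures\<close>

definition S_measurable_by ::
  "('f, 'r) language \<Rightarrow> ('f, 'r, 'a) fo_structure \<Rightarrow> ('a list set \<Rightarrow> 's::measuring_semiring) \<Rightarrow> bool"
where
  "S_measurable_by L M h \<longleftrightarrow>
     (\<forall>n X. definable L M n X \<and> finite X \<longrightarrow> h X = of_nat (card X)) \<and>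
     (\<forall>n X Y. definable L M n X \<and> definable L M n Y \<and> X \<inter> Y = {} \<longrightarrow> h (X \<union> Y) = h X + h Y) \<and>
     (\<forall>n m \<phi>. formula_in L (n + m) \<phi> \<longrightarrow>
        (let F = {h (solutions M n \<phi> b) | b. length b = m} in
          finite F \<and>
          (\<forall>f\<in>F. definable_over L M {} m {b. length b = m \<and> h (solutions M n \<phi> b) = f}))) \<and>
     (\<forall>n m X Y p f.
        definable L M n X \<and> definable L M m Y \<and> p ` X \<subseteq> Y \<and>
        definable L M (n + m) {x @ p x | x. x \<in> X} \<and>
        (\<forall>a\<in>Y. h {x \<in> X. p x = a} = f) \<longrightarrow> h X = f * h Y)"

definition dimensions ::
  "('f, 'r) language \<Rightarrow> ('f, 'r, 'a) fo_structure \<Rightarrow> ('a list set \<Rightarrow> 's::measuring_semiring) \<Rightarrow> 's sdim set"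
where
  "dimensions L M h = {sdim_of (h X) | X. \<exists>n. definable L M n X}"


section \<open>Dividing, forking and D-rank\<close>

text \<open>Ordinals are represented by well-orders on arbitrary types and compared by \<^const>\<open>ordLeq\<close>.
  An element of a well-order stands for the ordinal given by its strict predecessors.\<close>

definition ordinal_at :: "'o rel \<Rightarrow> 'o \<Rightarrow> 'o rel" where
  "ordinal_at r \<alpha> = Restr r (underS r \<alpha>)"

text \<open>The cardinal of the set of \<open>L\<close>-formulas is \<open>|L| + \<aleph>\<^sub>0\<close>, so \<open>small\<close> means of cardinality at most
  \<open>|L| + \<aleph>\<^sub>0\<close> and \<open>sufficiently_saturated\<close> means \<open>(|L| + \<aleph>\<^sub>0)\<^sup>+\<close>-saturated: \<open>P\<close> below is a
  1-type over \<open>B\<close>, given by the sets its formulas define. In such a model all complete types over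
  small sets are realised, and dividing over small sets may be tested on sequences of tuples of the
  model itself.\<close>

definition small :: "('f, 'r) language \<Rightarrow> 'u set \<Rightarrow> bool" where
  "small L B \<longleftrightarrow> B \<lesssim> {\<phi> :: ('f, 'r) fm. wf_fm L \<phi>}"

definition sufficiently_saturated ::
  "('f, 'r) language \<Rightarrow> ('f, 'r, 'u) fo_structure \<Rightarrow> bool" where
  "sufficiently_saturated L N \<longleftrightarrow>
     (\<forall>B P. small L B \<and> (\<forall>X\<in>P. definable_over L N B 1 X) \<and>
            (\<forall>Q. Q \<subseteq> P \<and> finite Q \<longrightarrow> \<Inter> Q \<noteq> {}) \<longrightarrow> \<Inter> P \<noteq> {})"

definition same_type ::
  "('f, 'r) language \<Rightarrow> ('f, 'r, 'u) fo_structure \<Rightarrow> 'u set \<Rightarrow> 'u list \<Rightarrow> 'u list \<Rightarrow> bool" where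
  "same_type L N A b c \<longleftrightarrow> length b = length c \<and>
     (\<forall>X. definable_over L N A (length b) X \<longrightarrow> (b \<in> X \<longleftrightarrow> c \<in> X))"

definition divides_over ::
  "('f, 'r) language \<Rightarrow> ('f, 'r, 'u) fo_structure \<Rightarrow> 'u set \<Rightarrow> nat \<Rightarrow> 'u list set \<Rightarrow> bool" where
  "divides_over L N A n Y \<longleftrightarrow>
     (\<exists>\<phi> b. formula_in L (n + length b) \<phi> \<and> Y = solutions N n \<phi> b \<and>
        (\<exists>(bs :: nat \<Rightarrow> 'u list) k. k > 0 \<and> (\<forall>i. same_type L N A b (bs i)) \<and>
           (\<forall>I. card I = k \<longrightarrow> (\<Inter>i\<in>I. solutions N n \<phi> (bs i)) = {})))"

definition forks_over ::
  "('f, 'r) language \<Rightarrow> ('f, 'r, 'u) fo_structure \<Rightarrow> 'u set \<Rightarrow> nat \<Rightarrow> 'u list set \<Rightarrow> bool" where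
  "forks_over L N A n Y \<longleftrightarrow> (\<exists>F. finite F \<and> (\<forall>Z\<in>F. divides_over L N A n Z) \<and> Y \<subseteq> \<Union> F)"

text \<open>\<open>type_forks_over L N A a B\<close>: the type of the tuple \<open>a\<close> over \<open>B\<close> forks over \<open>A\<close>.\<close>

definition type_forks_over ::
  "('f, 'r) language \<Rightarrow> ('f, 'r, 'u) fo_structure \<Rightarrow> 'u set \<Rightarrow> 'u list \<Rightarrow> 'u set \<Rightarrow> bool" where
  "type_forks_over L N A a B \<longleftrightarrow>
     (\<exists>Y. definable_over L N B (length a) Y \<and> a \<in> Y \<and> forks_over L N A (length a) Y)"

text \<open>No complete type forks over all finite subsets of its domain. The type argument is the
  universe of the saturated models in which this is tested; the property has its intended meaning
  when \<open>'u\<close> is large enough to carry a sufficiently saturated model of \<open>T\<close>, so that it should be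
  used with \<open>'u\<close> an arbitrary type variable.\<close>

definition supersimple :: "'u itself \<Rightarrow> ('f, 'r) language \<Rightarrow> ('f, 'r) fm set \<Rightarrow> bool" where
  "supersimple _ L T \<longleftrightarrow>
     (\<forall>N :: ('f, 'r, 'u) fo_structure. models N T \<and> sufficiently_saturated L N \<longrightarrow>
        (\<forall>a B. small L B \<longrightarrow> (\<exists>A. finite A \<and> A \<subseteq> B \<and> \<not> type_forks_over L N A a B)))"

text \<open>\<open>D_rank_ge L N r \<alpha> n X\<close>: the D-rank of the definable set \<open>X \<subseteq> N\<^sup>n\<close> is at least the ordinal
  represented by the element \<open>\<alpha>\<close> of the well-order \<open>r\<close>. The equation
  \<open>underS r \<alpha> = under r \<beta>\<close> says that \<open>\<alpha>\<close> is the successor of \<open>\<beta>\<close>.\<close>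

inductive D_rank_ge ::
  "('f, 'r) language \<Rightarrow> ('f, 'r, 'u) fo_structure \<Rightarrow> 'o rel \<Rightarrow> 'o \<Rightarrow> nat \<Rightarrow> 'u list set \<Rightarrow> bool"
  for L N r where
  zero: "\<lbrakk>\<alpha> \<in> Field r; underS r \<alpha> = {}; X \<noteq> {}\<rbrakk> \<Longrightarrow> D_rank_ge L N r \<alpha> n X"
| succ: "\<lbrakk>\<beta> \<in> underS r \<alpha>; underS r \<alpha> = under r \<beta>;
          small L A; definable_over L N A n X; definable L N n Y; Y \<subseteq> X;
          divides_over L N A n Y; D_rank_ge L N r \<beta> n Y\<rbrakk> \<Longrightarrow> D_rank_ge L N r \<alpha> n X"
| limit: "\<lbrakk>underS r \<alpha> \<noteq> {}; \<not> (\<exists>\<beta>\<in>underS r \<alpha>. underS r \<alpha> = under r \<beta>);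
          \<And>\<beta>. \<beta> \<in> underS r \<alpha> \<Longrightarrow> D_rank_ge L N r \<beta> n X\<rbrakk> \<Longrightarrow> D_rank_ge L N r \<alpha> n X"

text \<open>\<open>D_rank_le TYPE('o) L N n X s\<close>: every ordinal \<open>\<alpha>\<close> (represented in a well-order on \<open>'o\<close>) such
  that the D-rank of \<open>X\<close> is at least \<open>\<alpha>\<close> satisfies \<open>\<alpha> \<le> s\<close>; in particular the D-rank is not
  \<open>\<infinity>\<close> once \<open>'o\<close> is large enough to carry an ordinal greater than \<open>s\<close>.\<close>

definition D_rank_le ::
  "'o itself \<Rightarrow> ('f, 'r) language \<Rightarrow> ('f, 'r, 'u) fo_structure \<Rightarrow> nat \<Rightarrow> 'u list set \<Rightarrow> 'd rel \<Rightarrow> bool"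
where
  "D_rank_le _ L N n X s \<longleftrightarrow>
     (\<forall>(r :: 'o rel) \<alpha>. Well_order r \<and> \<alpha> \<in> Field r \<and> D_rank_ge L N r \<alpha> n X \<longrightarrow>
        (ordinal_at r \<alpha>, s) \<in> ordLeq)"

end

theory Submission
  imports Defs
begin

text \<open>
  Two facts carry the theorem. First, the measure \<open>h\<close> passes from \<open>M\<close> to every model \<open>N\<close> of
  \<open>Th(M)\<close>. The measures of the members of a definable family take finitely many values, and each
  value is taken on a set of parameters that is definable without parameters; so the defining
  formulas assign a value to every definable set of \<open>N\<close>. Any property of finitely many definable
  sets of \<open>N\<close> that speaks of their values and of which cells of their Venn diagram are empty is
  expressed by a sentence, and hence is witnessed by definable sets of \<open>M\<close>
  (\<open>reflect_family\<close>). All computations with measures therefore take place in \<open>M\<close> itself. The value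
  is part of the type of the parameters (\<open>hN_same_type\<close>) and agrees with \<open>h\<close> along elementary
  embeddings (\<open>hN_elementary_embedding\<close>).

  Second, dividing lowers the dimension (\<open>dividing_drops_dim\<close>). Suppose that \<open>X\<close> is defined over
  \<open>A\<close> and that \<open>Z\<close> divides over \<open>A\<close>, as witnessed by a \<open>k\<close>-inconsistent sequence of conjugates \<open>Z\<^sub>i\<close>
  of \<open>Z\<close>. The sets \<open>Z\<^sub>i \<inter> X\<close> all have the same measure \<open>f\<close>, and every point of \<open>X\<close> lies in at most
  \<open>k - 1\<close> of them, so that taking \<open>K\<close> of them gives \<open>K f \<le> (k - 1) h(X)\<close>. If \<open>Z \<inter> X\<close> had
  the dimension of \<open>X\<close>, then \<open>h(X) \<le> q f\<close> for some \<open>q\<close>, and \<open>K = (k - 1) q + 1\<close> would give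
  \<open>(m + 1) f \<le> m f\<close> with \<open>m = (k - 1) q\<close>. When \<open>Z \<inter> X\<close> is nonempty, \<open>f\<close> is positive, and the
  axiom of measuring semirings makes the multiples of a positive element strictly increasing
  (\<open>multiples_strict_mono\<close>), a contradiction.

  The bound on the rank follows by induction along its definition: each successor step passes to a
  nonempty dividing subset, which costs at least one step in the well-ordered set of dimensions. For
  supersimplicity, choose a set \<open>X\<close> of least dimension among the \<open>B\<close>-definable sets containing the tuple
  \<open>a\<close>, and let \<open>A\<close> be a finite set of parameters defining \<open>X\<close>. If the type of \<open>a\<close> over \<open>B\<close> forked
  over \<open>A\<close>, then some \<open>B\<close>-definable subset of \<open>X\<close> containing \<open>a\<close>, which again has the dimension of
  \<open>X\<close>, would be covered by finitely many intersections of \<open>X\<close> with sets that divide over \<open>A\<close>. The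
  dimension of a finite union is attained by one of its members (\<open>dim_cover\<close>), but each of these
  intersections has smaller dimension than \<open>X\<close>.
\<close>

section \<open>Measuring semirings and sets of bounded overlap\<close>

subclass (in least_zero_ordered_semiring) ordered_comm_semiring
proof
  show "a \<le> b \<Longrightarrow> c + a \<le> c + b" for a b c
    using add_right_monotone by (simp add: add.commute)
  show "a \<le> b \<Longrightarrow> 0 \<le> c \<Longrightarrow> c * a \<le> c * b" for a b c
    using mult_right_monotone by (simp add: mult.commute)
qed

lemma le_sdim_iff:
  "sdim_of a \<le> sdim_of b \<longleftrightarrow> (\<exists>n>0. a \<le> of_nat n * (b :: 's::least_zero_ordered_semiring))"
  by (simp add: less_eq_sdim.abs_eq arch_le_iff)

text \<open>The measuring axiom adds \<open>f\<close> to both sides of \<open>m f < (m + 1) f\<close>; it applies because the larger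
  side is a positive multiple of \<open>f\<close> and so has the dimension of \<open>f\<close>.\<close>

lemma multiples_strict_mono:
  fixes f :: "'s::measuring_semiring"
  assumes "0 < f"
  shows "of_nat m * f < of_nat (Suc m) * f"
proof (induction m)
  case (Suc m)
  have "arch_equiv (of_nat (Suc m) * f) f"
  proof -
    have "f \<le> of_nat (Suc m) * f"
      using mult_right_mono[of 1 "of_nat (Suc m)" f] zero_least[of f] zero_least[of "of_nat m * f"]
        add_left_mono[of 0 "of_nat m * f" f] by (simp add: algebra_simps)
    then show ?thesis
      unfolding arch_equiv_def by (intro exI[of _ "Suc m"]) simp
  qed
  from measuring_strict[OF Suc.IH this] show ?case
    by (simp add: algebra_simps)
qed (use assms in simp)

text \<open>Integrating over \<open>X\<close> the number of sets \<open>Z\<^sub>i\<close> that contain a point, which is at most \<open>k\<close>, gives the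
  bound. Induction on \<open>I\<close> avoids the decomposition into cells: outside a chosen \<open>Z\<^sub>i\<close> the other sets
  still have overlap at most \<open>k\<close>, and inside \<open>Z\<^sub>i\<close> they have overlap at most \<open>k - 1\<close>.\<close>

lemma sum_measure_bounded_overlap:
  fixes \<mu> :: "'b set \<Rightarrow> 's::least_zero_ordered_semiring"
  assumes Int: "\<And>X Y. X \<in> \<A> \<Longrightarrow> Y \<in> \<A> \<Longrightarrow> X \<inter> Y \<in> \<A>"
    and Diff: "\<And>X Y. X \<in> \<A> \<Longrightarrow> Y \<in> \<A> \<Longrightarrow> X - Y \<in> \<A>"
    and additive: "\<And>X Y. X \<in> \<A> \<Longrightarrow> Y \<in> \<A> \<Longrightarrow> X \<inter> Y = {} \<Longrightarrow> \<mu> (X \<union> Y) = \<mu> X + \<mu> Y"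
    and empty: "\<mu> {} = 0"
    and "finite I" "X \<in> \<A>" "\<And>i. i \<in> I \<Longrightarrow> Z i \<in> \<A>" "\<And>i. i \<in> I \<Longrightarrow> Z i \<subseteq> X"
    and "\<And>x. x \<in> X \<Longrightarrow> card {i \<in> I. x \<in> Z i} \<le> k"
  shows "(\<Sum>i\<in>I. \<mu> (Z i)) \<le> of_nat k * \<mu> X"
  using assms(5-)
proof (induction I arbitrary: X Z k)
  case empty
  then show ?case
    by (simp add: zero_least)
next
  case (insert i I)
  have Zi: "Z i \<in> \<A>" "Z i \<subseteq> X"
    using insert.prems by auto
  have split: "\<mu> Y = \<mu> (Y \<inter> Z i) + \<mu> (Y - Z i)" if "Y \<in> \<A>" for Y
    using additive[of "Y \<inter> Z i" "Y - Z i"] Int[OF that Zi(1)] Diff[OF that Zi(1)]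
    by (metis Int_Diff_disjoint Int_Diff_Un)
  have outside: "(\<Sum>j\<in>I. \<mu> (Z j - Z i)) \<le> of_nat k * \<mu> (X - Z i)"
  proof (rule insert.IH)
    fix x
    assume x: "x \<in> X - Z i"
    then have "{j \<in> I. x \<in> Z j - Z i} = {j \<in> insert i I. x \<in> Z j}"
      by auto
    with insert.prems(4)[of x] x show "card {j \<in> I. x \<in> Z j - Z i} \<le> k"
      by simp
  qed (use insert.prems Diff in auto)
  have inside: "(\<Sum>j\<in>I. \<mu> (Z j \<inter> Z i)) + \<mu> (Z i) \<le> of_nat k * \<mu> (Z i)"
  proof (cases "Z i = {}")
    case True
    then show ?thesis
      by (simp add: assms(4))
  next
    case False
    then obtain x0 where "x0 \<in> Z i"
      by blast
    then have "card {i} \<le> card {j \<in> insert i I. x0 \<in> Z j}"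
      by (intro card_mono) (use insert.hyps in auto)
    also have "\<dots> \<le> k"
      using insert.prems(4)[of x0] Zi(2) \<open>x0 \<in> Z i\<close> by blast
    finally have k: "k = Suc (k - 1)"
      by simp
    have "(\<Sum>j\<in>I. \<mu> (Z j \<inter> Z i)) \<le> of_nat (k - 1) * \<mu> (Z i)"
    proof (rule insert.IH)
      fix x
      assume x: "x \<in> Z i"
      then have "{j \<in> insert i I. x \<in> Z j} = insert i {j \<in> I. x \<in> Z j \<inter> Z i}"
        by auto
      then have "card {j \<in> insert i I. x \<in> Z j} = Suc (card {j \<in> I. x \<in> Z j \<inter> Z i})"
        using insert.hyps by simp
      with insert.prems(4)[of x] x Zi(2) show "card {j \<in> I. x \<in> Z j \<inter> Z i} \<le> k - 1"
        by fastforce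
    qed (use insert.prems Int Zi in auto)
    then have "(\<Sum>j\<in>I. \<mu> (Z j \<inter> Z i)) + \<mu> (Z i) \<le> of_nat (k - 1) * \<mu> (Z i) + \<mu> (Z i)"
      by (rule add_right_mono)
    also have "\<dots> = of_nat k * \<mu> (Z i)"
      by (subst (2) k) (simp add: algebra_simps)
    finally show ?thesis .
  qed
  have "(\<Sum>j\<in>I. \<mu> (Z j)) = (\<Sum>j\<in>I. \<mu> (Z j \<inter> Z i)) + (\<Sum>j\<in>I. \<mu> (Z j - Z i))"
    unfolding sum.distrib[symmetric] by (rule sum.cong) (use split insert.prems(2) in auto)
  then have "(\<Sum>j\<in>insert i I. \<mu> (Z j)) =
      ((\<Sum>j\<in>I. \<mu> (Z j \<inter> Z i)) + \<mu> (Z i)) + (\<Sum>j\<in>I. \<mu> (Z j - Z i))"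
    using insert.hyps by (simp add: algebra_simps)
  also have "\<dots> \<le> of_nat k * \<mu> (Z i) + of_nat k * \<mu> (X - Z i)"
    by (rule add_mono[OF inside outside])
  also have "\<dots> = of_nat k * \<mu> X"
    using split[OF insert.prems(1)] Zi(2) by (simp add: distrib_left Int_absorb1)
  finally show ?case .
qed

section \<open>Renaming variables in formulas\<close>

lemma eval_tm_cong:
  "(\<And>i. i \<in> vars_tm t \<Longrightarrow> e i = e' i) \<Longrightarrow> eval_tm M e t = eval_tm M e' t"
proof (induction t)
  case (Fun f ts)
  then have "map (eval_tm M e) ts = map (eval_tm M e') ts"
    by auto
  then show ?case
    by (simp only: eval_tm.simps)
qed simp

lemma sat_cong:
  "(\<And>i. i \<in> free_vars \<phi> \<Longrightarrow> e i = e' i) \<Longrightarrow> sat M e \<phi> = sat M e' \<phi>"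
proof (induction \<phi> arbitrary: e e')
  case (Eq s t)
  then show ?case
    using eval_tm_cong[of s e e' M] eval_tm_cong[of t e e' M] by simp
next
  case (Rel r ts)
  then have "map (eval_tm M e) ts = map (eval_tm M e') ts"
    by (auto intro!: eval_tm_cong)
  then show ?case
    by (simp only: sat.simps)
next
  case (Neg \<phi>)
  then show ?case
    by (metis free_vars.simps(3) sat.simps(3))
next
  case (Conj \<phi> \<psi>)
  show ?case
    using Conj.IH(1)[of e e'] Conj.IH(2)[of e e'] Conj.prems by simp
next
  case (Exi i \<phi>)
  have "sat M (e(i := a)) \<phi> = sat M (e'(i := a)) \<phi>" for a
    by (rule Exi.IH) (use Exi.prems in auto)
  then show ?case
    by simp
qed

lemma finite_vars_tm: "finite (vars_tm t)"
  by (induction t) auto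

lemma finite_free_vars: "finite (free_vars \<phi>)"
  by (induction \<phi>) (auto simp: finite_vars_tm)

primrec rename_tm :: "(nat \<Rightarrow> nat) \<Rightarrow> 'f tm \<Rightarrow> 'f tm" where
  "rename_tm g (Var i) = Var (g i)"
| "rename_tm g (Fun f ts) = Fun f (map (rename_tm g) ts)"

text \<open>A bound variable is replaced by one outside the image of the free variables, which prevents
  capture and makes \<open>sat_rename_fm\<close> hold for an arbitrary \<open>g\<close>.\<close>

primrec rename_fm :: "('f, 'r) fm \<Rightarrow> (nat \<Rightarrow> nat) \<Rightarrow> ('f, 'r) fm" where
  "rename_fm (Eq s t) g = Eq (rename_tm g s) (rename_tm g t)"
| "rename_fm (Rel r ts) g = Rel r (map (rename_tm g) ts)"
| "rename_fm (Neg \<phi>) g = Neg (rename_fm \<phi> g)"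
| "rename_fm (Conj \<phi> \<psi>) g = Conj (rename_fm \<phi> g) (rename_fm \<psi> g)"
| "rename_fm (Exi i \<phi>) g =
     (let z = LEAST z. z \<notin> g ` (free_vars \<phi> - {i}) in Exi z (rename_fm \<phi> (g(i := z))))"

lemma wf_rename_tm: "wf_tm L t \<Longrightarrow> wf_tm L (rename_tm g t)"
  by (induction t) (auto simp: list_all_iff)

lemma wf_rename_fm: "wf_fm L \<phi> \<Longrightarrow> wf_fm L (rename_fm \<phi> g)"
  by (induction \<phi> arbitrary: g) (auto simp: list_all_iff wf_rename_tm Let_def)

lemma eval_rename_tm: "eval_tm M e (rename_tm g t) = eval_tm M (e \<circ> g) t"
proof (induction t)
  case (Fun f ts)
  then have "map (eval_tm M e \<circ> rename_tm g) ts = map (eval_tm M (e \<circ> g)) ts"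
    by (simp add: o_def)
  then show ?case
    by (simp only: rename_tm.simps eval_tm.simps map_map)
qed simp

lemma vars_rename_tm: "vars_tm (rename_tm g t) = g ` vars_tm t"
  by (induction t) auto

lemma fresh_variable:
  "(LEAST z. z \<notin> g ` (free_vars \<phi> - {i})) \<notin> (g :: nat \<Rightarrow> nat) ` (free_vars \<phi> - {i})"
proof -
  have "finite (g ` (free_vars \<phi> - {i}))"
    by (simp add: finite_free_vars)
  then have "\<exists>z. z \<notin> g ` (free_vars \<phi> - {i})"
    by (rule ex_new_if_finite[OF infinite_UNIV_nat])
  then show ?thesis
    by (rule LeastI_ex)
qed

lemma free_vars_rename_fm: "free_vars (rename_fm \<phi> g) \<subseteq> g ` free_vars \<phi>"
proof (induction \<phi> arbitrary: g)
  case (Conj \<phi> \<psi>)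
  then show ?case
    by (simp add: image_Un) blast
next
  case (Exi i \<phi>)
  define z where "z = (LEAST z. z \<notin> g ` (free_vars \<phi> - {i}))"
  have "free_vars (rename_fm \<phi> (g(i := z))) - {z} \<subseteq> (g(i := z)) ` free_vars \<phi> - {z}"
    using Exi.IH by blast
  also have "\<dots> \<subseteq> g ` (free_vars \<phi> - {i})"
    by auto
  finally show ?case
    by (simp add: Let_def flip: z_def)
qed (auto simp: vars_rename_tm)

lemma sat_rename_fm: "sat M e (rename_fm \<phi> g) = sat M (e \<circ> g) \<phi>"
proof (induction \<phi> arbitrary: g e)
  case (Rel r ts)
  have "map (eval_tm M e \<circ> rename_tm g) ts = map (eval_tm M (e \<circ> g)) ts"
    by (simp add: eval_rename_tm)
  then show ?case
    by (simp only: rename_fm.simps sat.simps map_map)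
next
  case (Exi i \<phi>)
  define z where "z = (LEAST z. z \<notin> g ` (free_vars \<phi> - {i}))"
  have "sat M (e(z := a) \<circ> g(i := z)) \<phi> = sat M ((e \<circ> g)(i := a)) \<phi>" for a
  proof (rule sat_cong)
    fix v
    assume "v \<in> free_vars \<phi>"
    then have "v = i \<or> g v \<noteq> z"
      using fresh_variable[of g \<phi> i] unfolding z_def by (metis DiffI image_eqI singletonD)
    then show "(e(z := a) \<circ> g(i := z)) v = ((e \<circ> g)(i := a)) v"
      by auto
  qed
  then show ?case
    by (simp only: rename_fm.simps Let_def sat.simps Exi.IH flip: z_def)
qed (auto simp: eval_rename_tm)

lemma sat_list_rename_fm:
  assumes "formula_in L k \<phi>"
  shows "sat_list M c (rename_fm \<phi> g) \<longleftrightarrow> sat_list M (map (\<lambda>i. c ! g i) [0..<k]) \<phi>"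
  unfolding sat_rename_fm
  by (rule sat_cong) (use assms in \<open>auto simp: formula_in_def\<close>)

section \<open>Properties defined by one formula in two structures\<close>

text \<open>Statements about \<open>M\<close> pass to \<open>N\<close> and back as pairs of properties of tuples that are defined by the
  same formula. Closure of such pairs under the logical operations takes the place of writing down
  formulas.\<close>

definition codefinable ::
  "('f, 'r) language \<Rightarrow> ('f, 'r, 'a) fo_structure \<Rightarrow> ('f, 'r, 'u) fo_structure \<Rightarrow> nat \<Rightarrow>
    ('a list \<Rightarrow> bool) \<Rightarrow> ('u list \<Rightarrow> bool) \<Rightarrow> bool" where
  "codefinable L M N m P Q \<longleftrightarrow>
     (\<exists>\<phi>. formula_in L m \<phi> \<and>
        (\<forall>c. length c = m \<longrightarrow> (sat_list M c \<phi> \<longleftrightarrow> P c)) \<and>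
        (\<forall>b. length b = m \<longrightarrow> (sat_list N b \<phi> \<longleftrightarrow> Q b)))"

lemma codefinable_formula:
  "formula_in L m \<phi> \<Longrightarrow> codefinable L M N m (\<lambda>c. sat_list M c \<phi>) (\<lambda>b. sat_list N b \<phi>)"
  unfolding codefinable_def by blast

lemma codefinable_cong:
  assumes "codefinable L M N m P Q"
    and "\<And>c. length c = m \<Longrightarrow> P c \<longleftrightarrow> P' c" "\<And>b. length b = m \<Longrightarrow> Q b \<longleftrightarrow> Q' b"
  shows "codefinable L M N m P' Q'"
  using assms unfolding codefinable_def by simp

lemma codefinable_Not:
  assumes "codefinable L M N m P Q"
  shows "codefinable L M N m (\<lambda>c. \<not> P c) (\<lambda>b. \<not> Q b)"
proof -
  obtain \<phi> where "formula_in L m \<phi>" "\<forall>c. length c = m \<longrightarrow> (sat_list M c \<phi> \<longleftrightarrow> P c)"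
    "\<forall>b. length b = m \<longrightarrow> (sat_list N b \<phi> \<longleftrightarrow> Q b)"
    using assms unfolding codefinable_def by blast
  then show ?thesis
    unfolding codefinable_def by (intro exI[of _ "Neg \<phi>"]) (simp add: formula_in_def)
qed

lemma codefinable_conj:
  assumes "codefinable L M N m P Q" "codefinable L M N m P' Q'"
  shows "codefinable L M N m (\<lambda>c. P c \<and> P' c) (\<lambda>b. Q b \<and> Q' b)"
proof -
  obtain \<phi> \<psi> where "formula_in L m \<phi>" "formula_in L m \<psi>"
    and "\<forall>c. length c = m \<longrightarrow> (sat_list M c \<phi> \<longleftrightarrow> P c)" "\<forall>c. length c = m \<longrightarrow> (sat_list M c \<psi> \<longleftrightarrow> P' c)"
    and "\<forall>b. length b = m \<longrightarrow> (sat_list N b \<phi> \<longleftrightarrow> Q b)" "\<forall>b. length b = m \<longrightarrow> (sat_list N b \<psi> \<longleftrightarrow> Q' b)"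
    using assms unfolding codefinable_def by blast
  then show ?thesis
    unfolding codefinable_def by (intro exI[of _ "Conj \<phi> \<psi>"]) (auto simp: formula_in_def)
qed

lemma codefinable_const: "codefinable L M N m (\<lambda>c. v) (\<lambda>b. v)"
proof -
  have "codefinable L M N m (\<lambda>c. True) (\<lambda>b. True)"
    unfolding codefinable_def
    by (intro exI[of _ "Exi 0 (Eq (Var 0) (Var 0))"]) (auto simp: formula_in_def)
  with codefinable_Not[OF this] show ?thesis
    by (cases v) simp_all
qed

lemma codefinable_iff:
  assumes "codefinable L M N m P Q" "codefinable L M N m P' Q'"
  shows "codefinable L M N m (\<lambda>c. P c \<longleftrightarrow> P' c) (\<lambda>b. Q b \<longleftrightarrow> Q' b)"
proof -
  have "codefinable L M N m (\<lambda>c. \<not> (P c \<and> \<not> P' c) \<and> \<not> (P' c \<and> \<not> P c))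
    (\<lambda>b. \<not> (Q b \<and> \<not> Q' b) \<and> \<not> (Q' b \<and> \<not> Q b))"
    by (intro codefinable_conj codefinable_Not assms)
  then show ?thesis
    by (rule codefinable_cong) blast+
qed

lemma codefinable_Ball:
  assumes "finite I" "\<And>i. i \<in> I \<Longrightarrow> codefinable L M N m (P i) (Q i)"
  shows "codefinable L M N m (\<lambda>c. \<forall>i\<in>I. P i c) (\<lambda>b. \<forall>i\<in>I. Q i b)"
  using assms
proof (induction I)
  case (insert i I)
  then have "codefinable L M N m (\<lambda>c. P i c \<and> (\<forall>i\<in>I. P i c)) (\<lambda>b. Q i b \<and> (\<forall>i\<in>I. Q i b))"
    by (intro codefinable_conj) auto
  then show ?case
    by simp
qed (simp add: codefinable_const)

lemma codefinable_reindex: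
  assumes "codefinable L M N k P Q" and g: "\<And>i. i < k \<Longrightarrow> g i < m"
  shows "codefinable L M N m (\<lambda>c. P (map (\<lambda>i. c ! g i) [0..<k])) (\<lambda>b. Q (map (\<lambda>i. b ! g i) [0..<k]))"
proof -
  obtain \<phi> where \<phi>: "formula_in L k \<phi>" "\<forall>c. length c = k \<longrightarrow> (sat_list M c \<phi> \<longleftrightarrow> P c)"
    "\<forall>b. length b = k \<longrightarrow> (sat_list N b \<phi> \<longleftrightarrow> Q b)"
    using assms unfolding codefinable_def by blast
  have "formula_in L m (rename_fm \<phi> g)"
    using \<phi>(1) g free_vars_rename_fm[of \<phi> g] wf_rename_fm unfolding formula_in_def by fastforce
  then show ?thesis
    unfolding codefinable_def
    by (intro exI[of _ "rename_fm \<phi> g"]) (simp add: sat_list_rename_fm[OF \<phi>(1)] \<phi>(2,3))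
qed

lemma codefinable_select:
  assumes "codefinable L M N k P Q" "length idx = k" "set idx \<subseteq> {..<m}"
  shows "codefinable L M N m (\<lambda>c. P (map ((!) c) idx)) (\<lambda>b. Q (map ((!) b) idx))"
proof -
  have sel: "map (\<lambda>i. c ! (idx ! i)) [0..<k] = map ((!) c) idx" for c :: "'z list"
    using assms(2) by (auto intro!: nth_equalityI)
  have "idx ! i < m" if "i < k" for i
    using assms(2,3) that nth_mem by fastforce
  from codefinable_reindex[OF assms(1), of "(!) idx", OF this] show ?thesis
    by (simp only: sel)
qed

text \<open>The first \<open>n\<close> entries form the point and the others the parameters. The lemma replaces the
  parameters by a longer tuple from which the old one is read off at the positions \<open>idx\<close>; several
  families thus acquire a common tuple of parameters.\<close>

lemma codefinable_select_parameters:
  assumes "codefinable L M N (n + k) P Q" "length idx = k" "set idx \<subseteq> {..<m}"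
  shows "codefinable L M N (n + m) (\<lambda>z. P (take n z @ map ((!) (drop n z)) idx))
           (\<lambda>z. Q (take n z @ map ((!) (drop n z)) idx))"
proof -
  have sel: "map ((!) z) ([0..<n] @ map ((+) n) idx) = take n z @ map ((!) (drop n z)) idx"
    if "length z = n + m" for z :: "'z list"
    using that assms(3) by (auto intro!: nth_equalityI simp: subset_iff nth_append)
  have "codefinable L M N (n + m) (\<lambda>z. P (map ((!) z) ([0..<n] @ map ((+) n) idx)))
          (\<lambda>z. Q (map ((!) z) ([0..<n] @ map ((+) n) idx)))"
    by (rule codefinable_select[OF assms(1)]) (use assms(2,3) in auto)
  then show ?thesis
    by (rule codefinable_cong) (simp_all only: sel)
qed

lemma codefinable_nth_eq:
  "i < m \<Longrightarrow> j < m \<Longrightarrow> codefinable L M N m (\<lambda>c. c ! i = c ! j) (\<lambda>b. b ! i = b ! j)"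
  unfolding codefinable_def by (intro exI[of _ "Eq (Var i) (Var j)"]) (simp add: formula_in_def)

lemma sat_list_snoc:
  assumes "formula_in L (Suc (length c)) \<phi>"
  shows "sat M ((\<lambda>i. c ! i)(length c := a)) \<phi> \<longleftrightarrow> sat_list M (c @ [a]) \<phi>"
  by (rule sat_cong) (use assms in \<open>auto simp: formula_in_def nth_append\<close>)

lemma codefinable_Ex_last:
  assumes "codefinable L M N (Suc m) P Q"
  shows "codefinable L M N m (\<lambda>c. \<exists>a. P (c @ [a])) (\<lambda>b. \<exists>a. Q (b @ [a]))"
proof -
  obtain \<phi> where \<phi>: "formula_in L (Suc m) \<phi>" "\<forall>c. length c = Suc m \<longrightarrow> (sat_list M c \<phi> \<longleftrightarrow> P c)"
    "\<forall>b. length b = Suc m \<longrightarrow> (sat_list N b \<phi> \<longleftrightarrow> Q b)"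
    using assms unfolding codefinable_def by blast
  have "formula_in L m (Exi m \<phi>)"
    using \<phi>(1) by (auto simp: formula_in_def less_Suc_eq)
  moreover have "sat_list M c (Exi m \<phi>) \<longleftrightarrow> (\<exists>a. P (c @ [a]))" if "length c = m" for c
    using that sat_list_snoc[of L c \<phi> M] \<phi>(1,2) by simp
  moreover have "sat_list N b (Exi m \<phi>) \<longleftrightarrow> (\<exists>a. Q (b @ [a]))" if "length b = m" for b
    using that sat_list_snoc[of L b \<phi> N] \<phi>(1,3) by simp
  ultimately show ?thesis
    unfolding codefinable_def by blast
qed

lemma codefinable_Ex_block:
  assumes "codefinable L M N (m + n) P Q"
  shows "codefinable L M N m (\<lambda>c. \<exists>x. length x = n \<and> P (c @ x)) (\<lambda>b. \<exists>x. length x = n \<and> Q (b @ x))"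
  using assms
proof (induction n arbitrary: P Q)
  case (Suc n)
  have "codefinable L M N m (\<lambda>c. \<exists>x. length x = n \<and> (\<exists>a. P ((c @ x) @ [a])))
          (\<lambda>b. \<exists>x. length x = n \<and> (\<exists>a. Q ((b @ x) @ [a])))"
    using Suc.IH[OF codefinable_Ex_last] Suc.prems by simp
  then show ?case
    by (rule codefinable_cong) (auto simp: length_Suc_conv_rev)
qed simp

text \<open>Points precede parameters in a tuple, but only a final block of variables can be quantified
  directly, since otherwise the remaining variables would not be an initial segment.\<close>

lemma codefinable_Ex_tuple:
  assumes "codefinable L M N (n + m) P Q"
  shows "codefinable L M N m (\<lambda>c. \<exists>x. length x = n \<and> P (x @ c)) (\<lambda>b. \<exists>x. length x = n \<and> Q (x @ b))"
proof -
  have swap: "map ((!) (c @ x)) ([m..<m + n] @ [0..<m]) = x @ c" if "length c = m" "length x = n"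
    for c x :: "'z list"
    using that by (auto intro!: nth_equalityI simp: nth_append)
  have "codefinable L M N (m + n) (\<lambda>z. P (map ((!) z) ([m..<m + n] @ [0..<m])))
          (\<lambda>z. Q (map ((!) z) ([m..<m + n] @ [0..<m])))"
    by (rule codefinable_select[OF assms]) auto
  from codefinable_Ex_block[OF this] show ?thesis
    by (rule codefinable_cong) (use swap in \<open>metis (no_types, lifting)\<close>)+
qed

text \<open>Otherwise \<open>Th(M)\<close> contains a sentence saying that no tuple has the property.\<close>

lemma codefinable_reflect:
  assumes "models N (Th L M)" "codefinable L M N m P Q" "length b = m" "Q b"
  obtains c where "length c = m" "P c"
proof -
  have "codefinable L M N 0 (\<lambda>e. \<exists>x. length x = m \<and> P (x @ e)) (\<lambda>e. \<exists>x. length x = m \<and> Q (x @ e))"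
    by (rule codefinable_Ex_tuple) (simp add: assms(2))
  then obtain \<sigma> where \<sigma>: "formula_in L 0 \<sigma>" "sat_list M [] \<sigma> \<longleftrightarrow> (\<exists>x. length x = m \<and> P x)"
    "sat_list N [] \<sigma> \<longleftrightarrow> (\<exists>x. length x = m \<and> Q x)"
    unfolding codefinable_def by auto
  have "Neg \<sigma> \<notin> Th L M"
    using assms(1,3,4) \<sigma>(3) unfolding models_def by auto
  then show ?thesis
    using \<sigma>(1,2) that unfolding Th_def formula_in_def by auto
qed

section \<open>Definable sets\<close>

lemma definable_over_if_codefinable:
  assumes "codefinable L M N (n + length b) P Q" "set b \<subseteq> A"
  shows "definable_over L M A n {x. length x = n \<and> P (x @ b)}"
  using assms unfolding codefinable_def definable_over_def solutions_def by fastforce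

lemma definable_over_if_codefinable':
  assumes "codefinable L M N (n + length b) P Q" "set b \<subseteq> A"
  shows "definable_over L N A n {x. length x = n \<and> Q (x @ b)}"
  using assms unfolding codefinable_def definable_over_def solutions_def by fastforce

lemma definable_overE:
  assumes "definable_over L N A n X"
  obtains b P where "set b \<subseteq> A" "codefinable L N N (n + length b) P P"
    "X = {x. length x = n \<and> P (x @ b)}"
  using assms codefinable_formula unfolding definable_over_def solutions_def by blast

lemma definable_over_length: "definable_over L N A n X \<Longrightarrow> x \<in> X \<Longrightarrow> length x = n"
  unfolding definable_over_def solutions_def by auto

lemma definable_over_mono: "definable_over L N A n X \<Longrightarrow> A \<subseteq> B \<Longrightarrow> definable_over L N B n X"
  unfolding definable_over_def by blast

lemma definable_over_finite:
  assumes "definable_over L N B n X"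
  obtains A where "finite A" "A \<subseteq> B" "definable_over L N A n X"
  using assms unfolding definable_over_def by (metis List.finite_set order_refl)

lemma definable_over_tuples: "definable_over L N A n {x. length x = n}"
  using definable_over_if_codefinable[of L N N n "[]" "\<lambda>_. True" "\<lambda>_. True" A] codefinable_const
  by fastforce

lemma definable_over_Compl:
  assumes "definable_over L N A n X"
  shows "definable_over L N A n ({x. length x = n} - X)"
proof -
  obtain b P where *: "set b \<subseteq> A" "codefinable L N N (n + length b) P P"
    "X = {x. length x = n \<and> P (x @ b)}"
    using assms by (rule definable_overE)
  have "{x. length x = n} - X = {x. length x = n \<and> \<not> P (x @ b)}"
    using *(3) by blast
  then show ?thesis
    using definable_over_if_codefinable[OF codefinable_Not[OF *(2)] *(1)] by simp
qed

lemma nth_initial: "map ((!) (b @ c)) [0..<length b] = b"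
  by (auto intro!: nth_equalityI simp: nth_append)

lemma nth_final: "map ((!) (b @ c)) [length b..<length b + length c] = c"
  by (auto intro!: nth_equalityI simp: nth_append)

lemma codefinable_conj_parameters:
  assumes "codefinable L M N (n + k) P Q" "codefinable L M N (n + l) P' Q'"
  shows "codefinable L M N (n + (k + l))
    (\<lambda>z. P (take n z @ map ((!) (drop n z)) [0..<k]) \<and> P' (take n z @ map ((!) (drop n z)) [k..<k + l]))
    (\<lambda>z. Q (take n z @ map ((!) (drop n z)) [0..<k]) \<and> Q' (take n z @ map ((!) (drop n z)) [k..<k + l]))"
  by (intro codefinable_conj codefinable_select_parameters[OF assms(1)]
      codefinable_select_parameters[OF assms(2)]) auto

lemma definable_over_Int:
  assumes "definable_over L N A n X" "definable_over L N A n Y"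
  shows "definable_over L N A n (X \<inter> Y)"
proof -
  obtain b P where *: "set b \<subseteq> A" "codefinable L N N (n + length b) P P"
    "X = {x. length x = n \<and> P (x @ b)}"
    using assms(1) by (rule definable_overE)
  obtain c Q where **: "set c \<subseteq> A" "codefinable L N N (n + length c) Q Q"
    "Y = {x. length x = n \<and> Q (x @ c)}"
    using assms(2) by (rule definable_overE)
  have "X \<inter> Y = {x. length x = n \<and> P (x @ b) \<and> Q (x @ c)}"
    using *(3) **(3) by blast
  moreover have "definable_over L N A n {x. length x = n \<and> P (x @ b) \<and> Q (x @ c)}"
    using definable_over_if_codefinable[of L N N n "b @ c", OF _ , of _ _ A]
      codefinable_conj_parameters[OF *(2) **(2)] *(1) **(1)
    by (force simp: nth_initial nth_final cong: conj_cong)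
  ultimately show ?thesis
    by simp
qed

lemma definable_over_Diff:
  assumes "definable_over L N A n X" "definable_over L N A n Y"
  shows "definable_over L N A n (X - Y)"
proof -
  have "X - Y = X \<inter> ({x. length x = n} - Y)"
    using definable_over_length[OF assms(1)] by blast
  then show ?thesis
    by (simp add: assms definable_over_Compl definable_over_Int)
qed

lemma definable_singleton:
  assumes "length a = n"
  shows "definable L N n {a}"
proof -
  have "codefinable L N N (n + length a) (\<lambda>z. \<forall>i\<in>{..<n}. z ! i = z ! (n + i)) (\<lambda>z. \<forall>i\<in>{..<n}. z ! i = z ! (n + i))"
    by (rule codefinable_Ball) (auto intro!: codefinable_nth_eq simp: assms)
  then have "definable L N n {x. length x = n \<and> (\<forall>i\<in>{..<n}. (x @ a) ! i = (x @ a) ! (n + i))}"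
    by (rule definable_over_if_codefinable) simp
  moreover have "{x. length x = n \<and> (\<forall>i\<in>{..<n}. (x @ a) ! i = (x @ a) ! (n + i))} = {a}"
    using assms by (auto simp: nth_append intro: nth_equalityI)
  ultimately show ?thesis
    by simp
qed

lemma parameter_positions:
  assumes "set b \<subseteq> set B"
  shows "\<exists>idx. set idx \<subseteq> {..<length B} \<and> map ((!) B) idx = b"
  using assms
proof (induction b)
  case (Cons y b)
  then obtain idx i where "set idx \<subseteq> {..<length B}" "map ((!) B) idx = b" "i < length B" "B ! i = y"
    by (auto simp: in_set_conv_nth)
  then show ?case
    by (intro exI[of _ "i # idx"]) simp
qed simp

section \<open>The measure on the structure itself\<close>

locale measured_structure =
  fixes L :: "('f, 'r) language" and M :: "('f, 'r, 'a) fo_structure"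
    and h :: "'a list set \<Rightarrow> 's::measuring_semiring"
  assumes measurable: "S_measurable_by L M h"
begin

lemma h_finite: "definable L M n X \<Longrightarrow> finite X \<Longrightarrow> h X = of_nat (card X)"
  using measurable unfolding S_measurable_by_def by blast

lemma h_additive:
  "definable L M n X \<Longrightarrow> definable L M n Y \<Longrightarrow> X \<inter> Y = {} \<Longrightarrow> h (X \<union> Y) = h X + h Y"
  using measurable unfolding S_measurable_by_def by blast

lemma h_family:
  assumes "formula_in L (n + m) \<phi>"
  shows "finite {h (solutions M n \<phi> b) | b. length b = m}"
    and "length c = m \<Longrightarrow>
      definable_over L M {} m {b. length b = m \<and> h (solutions M n \<phi> b) = h (solutions M n \<phi> c)}"
  using measurable assms unfolding S_measurable_by_def Let_def by blast+

lemma h_empty: "h {} = 0"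
proof -
  have "definable L M 0 ({x. length x = 0} - {x. length x = 0})"
    by (intro definable_over_Diff definable_over_tuples)
  then show ?thesis
    using h_finite[of 0 "{}"] by simp
qed

lemma h_split:
  assumes "definable L M n X" "definable L M n Y"
  shows "h X = h (X \<inter> Y) + h (X - Y)"
  using h_additive[OF definable_over_Int[OF assms] definable_over_Diff[OF assms]]
  by (metis Int_Diff_Un Int_Diff_disjoint)

lemma h_mono:
  assumes "definable L M n X" "definable L M n Y" "X \<subseteq> Y"
  shows "h X \<le> h Y"
proof -
  have "h Y = h X + h (Y - X)"
    using h_split[OF assms(2,1)] assms(3) by (simp add: Int_absorb1)
  then show ?thesis
    using add_left_mono[OF zero_least, of "h X" "h (Y - X)"] by simp
qed

text \<open>A point has measure \<open>1\<close>, and \<open>1 \<noteq> 0\<close>.\<close>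

lemma h_positive:
  assumes "definable L M n X" "X \<noteq> {}"
  shows "0 < h X"
proof -
  obtain a where "a \<in> X"
    using assms(2) by blast
  then have a: "definable L M n {a}"
    using definable_singleton definable_over_length[OF assms(1)] by blast
  have "1 = h {a}"
    using h_finite[OF a] by simp
  also have "\<dots> \<le> h X"
    by (rule h_mono[OF a assms(1)]) (simp add: \<open>a \<in> X\<close>)
  finally show ?thesis
    using zero_least[of "1::'s"] by (metis order_less_le_trans order_le_less zero_neq_one)
qed

lemma h_subadditive:
  assumes "finite I" "definable L M n Y" "\<And>i. i \<in> I \<Longrightarrow> definable L M n (Z i)" "Y \<subseteq> (\<Union>i\<in>I. Z i)"
  shows "h Y \<le> (\<Sum>i\<in>I. h (Z i))"
  using assms
proof (induction I arbitrary: Y)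
  case empty
  then show ?case
    by (simp add: h_empty)
next
  case (insert i I)
  have Zi: "definable L M n (Z i)"
    using insert.prems by blast
  have "h (Y - Z i) \<le> (\<Sum>j\<in>I. h (Z j))"
    by (rule insert.IH) (use insert.prems definable_over_Diff[OF insert.prems(1) Zi] in auto)
  moreover have "h (Y \<inter> Z i) \<le> h (Z i)"
    by (rule h_mono[OF definable_over_Int[OF insert.prems(1) Zi] Zi]) simp
  ultimately show ?case
    using h_split[OF insert.prems(1) Zi] insert.hyps by (simp add: add_mono)
qed

lemma h_bounded_overlap:
  assumes "finite I" "definable L M n X" "\<And>i. i \<in> I \<Longrightarrow> definable L M n (Z i)"
    "\<And>i. i \<in> I \<Longrightarrow> Z i \<subseteq> X" "\<And>x. x \<in> X \<Longrightarrow> card {i \<in> I. x \<in> Z i} \<le> k"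
  shows "(\<Sum>i\<in>I. h (Z i)) \<le> of_nat k * h X"
  by (rule sum_measure_bounded_overlap[of "{X. definable L M n X}"])
    (use assms definable_over_Int definable_over_Diff h_additive h_empty in auto)

end

section \<open>Transfer of the measure to models of the theory\<close>

locale measured_theory_model = measured_structure L M h
  for L :: "('f, 'r) language" and M :: "('f, 'r, 'a) fo_structure"
    and h :: "'a list set \<Rightarrow> 's::measuring_semiring" +
  fixes N :: "('f, 'r, 'u) fo_structure"
  assumes model: "models N (Th L M)"
begin

text \<open>In \<open>M\<close> the member of the family with parameter \<open>c\<close> has one of finitely many measures \<open>f\<close>, and each
  of the conditions \<open>h = f\<close> is a formula in \<open>c\<close>. That one of these formulas holds at every parameter
  is part of the theory.\<close>

lemma value_exists:
  assumes "codefinable L M N (n + k) P Q" "length b = k"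
  obtains f V where "codefinable L M N k (\<lambda>c. h {x. length x = n \<and> P (x @ c)} = f) V" "V b"
proof (rule ccontr)
  assume none: "\<not> thesis"
  obtain \<phi> where \<phi>: "formula_in L (n + k) \<phi>"
    "\<And>c. length c = k \<Longrightarrow> solutions M n \<phi> c = {x. length x = n \<and> P (x @ c)}"
    using assms(1) unfolding codefinable_def solutions_def by fastforce
  define F where "F = {h (solutions M n \<phi> c) | c. length c = k}"
  have "\<exists>V. codefinable L M N k (\<lambda>c. h {x. length x = n \<and> P (x @ c)} = f) V" if f: "f \<in> F" for f
  proof -
    obtain c0 where c0: "length c0 = k" "f = h (solutions M n \<phi> c0)"
      using f unfolding F_def by blast
    obtain \<theta> where "formula_in L k \<theta>"
      "{c. length c = k \<and> h (solutions M n \<phi> c) = f} = solutions M k \<theta> []"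
      using h_family(2)[OF \<phi>(1) c0(1)] unfolding definable_over_def c0(2) by auto
    then have \<theta>: "codefinable L M N k (\<lambda>c. sat_list M c \<theta>) (\<lambda>b. sat_list N b \<theta>)"
      "\<And>c. length c = k \<Longrightarrow> sat_list M c \<theta> \<longleftrightarrow> h (solutions M n \<phi> c) = f"
      by (auto simp: codefinable_formula solutions_def[of M k] set_eq_iff)
    have "codefinable L M N k (\<lambda>c. h {x. length x = n \<and> P (x @ c)} = f) (\<lambda>b. sat_list N b \<theta>)"
      by (rule codefinable_cong[OF \<theta>(1)]) (simp_all add: \<theta>(2) \<phi>(2))
    then show ?thesis
      by blast
  qed
  then have "\<exists>V. \<forall>f\<in>F. codefinable L M N k (\<lambda>c. h {x. length x = n \<and> P (x @ c)} = f) (V f)"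
    by (intro bchoice ballI)
  then obtain V where
    V: "\<forall>f\<in>F. codefinable L M N k (\<lambda>c. h {x. length x = n \<and> P (x @ c)} = f) (V f)"
    by (elim exE)
  have "finite F"
    unfolding F_def by (rule h_family(1)[OF \<phi>(1)])
  then have "codefinable L M N k (\<lambda>c. \<forall>f\<in>F. \<not> h {x. length x = n \<and> P (x @ c)} = f) (\<lambda>b. \<forall>f\<in>F. \<not> V f b)"
    by (rule codefinable_Ball) (rule codefinable_Not[OF V[rule_format]])
  moreover have "\<forall>f\<in>F. \<not> V f b"
    using none that V by blast
  ultimately obtain c where "length c = k" "\<forall>f\<in>F. \<not> h {x. length x = n \<and> P (x @ c)} = f"
    by (rule codefinable_reflect[OF model _ assms(2)])
  then show False
    unfolding F_def using \<phi>(2) by fastforce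
qed

text \<open>In the data witnessing that a set \<open>X\<close> of \<open>N\<close> has the value \<open>f\<close>, the pair \<open>P\<close>, \<open>Q\<close> is the family
  to which \<open>X\<close> belongs with parameter \<open>b\<close>, and \<open>V\<close> is the property of a parameter of \<open>N\<close> that in \<open>M\<close>
  says that the measure is \<open>f\<close>.\<close>

definition representation ::
  "nat \<Rightarrow> 'u list set \<Rightarrow> 's \<Rightarrow> 'u list \<Rightarrow> ('a list \<Rightarrow> bool) \<Rightarrow> ('u list \<Rightarrow> bool) \<Rightarrow> ('u list \<Rightarrow> bool) \<Rightarrow> bool"
where
  "representation n X f b P Q V \<longleftrightarrow>
     codefinable L M N (n + length b) P Q \<and> X = {x. length x = n \<and> Q (x @ b)} \<and>
     codefinable L M N (length b) (\<lambda>c. h {x. length x = n \<and> P (x @ c)} = f) V \<and> V b"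

definition transferred_value :: "nat \<Rightarrow> 'u list set \<Rightarrow> 's \<Rightarrow> bool" where
  "transferred_value n X f \<longleftrightarrow> (\<exists>b P Q V. representation n X f b P Q V)"

text \<open>The sets \<open>X'\<close> of \<open>M\<close> have the prescribed measures, and a cell of their Venn diagram is empty iff
  the corresponding cell for the sets \<open>X\<close> of \<open>N\<close> is.\<close>

definition reflects :: "nat \<Rightarrow> 'i set \<Rightarrow> ('i \<Rightarrow> 'u list set) \<Rightarrow> ('i \<Rightarrow> 's) \<Rightarrow> ('i \<Rightarrow> 'a list set) \<Rightarrow> bool" where
  "reflects n I X f X' \<longleftrightarrow>
     (\<forall>i\<in>I. definable L M n (X' i) \<and> h (X' i) = f i) \<and>
     (\<forall>x'. length x' = n \<longrightarrow> (\<exists>x. length x = n \<and> (\<forall>i\<in>I. x \<in> X i \<longleftrightarrow> x' \<in> X' i))) \<and>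
     (\<forall>x. length x = n \<longrightarrow> (\<exists>x'. length x' = n \<and> (\<forall>i\<in>I. x \<in> X i \<longleftrightarrow> x' \<in> X' i)))"

lemma reflectsD:
  assumes "reflects n I X f X'" "i \<in> I"
  shows "definable L M n (X' i)" "h (X' i) = f i"
  using assms unfolding reflects_def by simp_all

lemma reflects_memberD:
  assumes "reflects n I X f X'" "i \<in> I" "x' \<in> X' i"
  obtains x where "\<forall>i\<in>I. x \<in> X i \<longleftrightarrow> x' \<in> X' i"
proof -
  have "length x' = n"
    by (rule definable_over_length[OF reflectsD(1)[OF assms(1,2)] assms(3)])
  then show ?thesis
    using assms(1) that unfolding reflects_def by blast
qed

text \<open>After passing to a common tuple of parameters, the required values and the emptiness or
  nonemptiness of each of the finitely many cells form a single formula in that tuple. It holds in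
  \<open>N\<close>, hence at some tuple of \<open>M\<close>.\<close>

lemma reflect_transferred_values:
  assumes "finite I" "\<And>i. i \<in> I \<Longrightarrow> transferred_value n (X i) (f i)"
  shows "\<exists>X'. reflects n I X f X'"
proof -
  obtain b P Q V where repr: "\<And>i. i \<in> I \<Longrightarrow> representation n (X i) (f i) (b i) (P i) (Q i) (V i)"
    using assms(2) unfolding transferred_value_def by metis
  then have *: "\<And>i. i \<in> I \<Longrightarrow> codefinable L M N (n + length (b i)) (P i) (Q i)"
    "\<And>i. i \<in> I \<Longrightarrow> X i = {x. length x = n \<and> Q i (x @ b i)}"
    "\<And>i. i \<in> I \<Longrightarrow>
      codefinable L M N (length (b i)) (\<lambda>c. h {x. length x = n \<and> P i (x @ c)} = f i) (V i)"
    "\<And>i. i \<in> I \<Longrightarrow> V i (b i)"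
    unfolding representation_def by blast+
  obtain B where B: "set B = (\<Union>i\<in>I. set (b i))"
    using finite_list[of "\<Union>i\<in>I. set (b i)"] assms(1) by auto
  have "\<exists>idx. set idx \<subseteq> {..<length B} \<and> map ((!) B) idx = b i" if "i \<in> I" for i
    by (rule parameter_positions) (use B that in blast)
  then obtain idx where idx: "\<And>i. i \<in> I \<Longrightarrow> set (idx i) \<subseteq> {..<length B}"
    "\<And>i. i \<in> I \<Longrightarrow> map ((!) B) (idx i) = b i"
    by metis
  have len: "length (idx i) = length (b i)" if "i \<in> I" for i
    using idx(2)[OF that] by (metis length_map)
  define X' where "X' c i = {x. length x = n \<and> P i (x @ map ((!) c) (idx i))}" for c i
  have params: "codefinable L M N (n + length B)
      (\<lambda>z. P i (take n z @ map ((!) (drop n z)) (idx i)))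
      (\<lambda>z. Q i (take n z @ map ((!) (drop n z)) (idx i)))" if "i \<in> I" for i
    by (rule codefinable_select_parameters[OF *(1)[OF that] len[OF that] idx(1)[OF that]])
  have sat: "codefinable L M N (length B)
      (\<lambda>c. \<forall>i\<in>I. h (X' c i) = f i) (\<lambda>b. \<forall>i\<in>I. V i (map ((!) b) (idx i)))"
    unfolding X'_def
    by (rule codefinable_Ball[OF assms(1)], rule codefinable_select[OF *(3) len idx(1)])
  have pattern: "codefinable L M N (length B)
      (\<lambda>c. \<exists>x. length x = n \<and> (\<forall>i\<in>I. x \<in> X' c i \<longleftrightarrow> i \<in> J))
      (\<lambda>c. \<exists>x. length x = n \<and> (\<forall>i\<in>I. Q i (x @ map ((!) c) (idx i)) \<longleftrightarrow> i \<in> J))" for J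
  proof -
    have "codefinable L M N (n + length B)
        (\<lambda>z. \<forall>i\<in>I. P i (take n z @ map ((!) (drop n z)) (idx i)) \<longleftrightarrow> i \<in> J)
        (\<lambda>z. \<forall>i\<in>I. Q i (take n z @ map ((!) (drop n z)) (idx i)) \<longleftrightarrow> i \<in> J)"
      by (intro codefinable_Ball[OF assms(1)] codefinable_iff params codefinable_const)
    from codefinable_Ex_tuple[OF this] show ?thesis
      by (rule codefinable_cong) (simp_all add: X'_def cong: conj_cong)
  qed
  have "codefinable L M N (length B)
      (\<lambda>c. (\<forall>i\<in>I. h (X' c i) = f i) \<and>
         (\<forall>J\<in>Pow I. (\<exists>x. length x = n \<and> (\<forall>i\<in>I. x \<in> X' c i \<longleftrightarrow> i \<in> J)) \<longleftrightarrow>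
            (\<exists>x. length x = n \<and> (\<forall>i\<in>I. x \<in> X i \<longleftrightarrow> i \<in> J))))
      (\<lambda>c. (\<forall>i\<in>I. V i (map ((!) c) (idx i))) \<and>
         (\<forall>J\<in>Pow I. (\<exists>x. length x = n \<and> (\<forall>i\<in>I. Q i (x @ map ((!) c) (idx i)) \<longleftrightarrow> i \<in> J)) \<longleftrightarrow>
            (\<exists>x. length x = n \<and> (\<forall>i\<in>I. x \<in> X i \<longleftrightarrow> i \<in> J))))"
    by (rule codefinable_conj[OF sat codefinable_Ball])
      (auto intro!: codefinable_iff pattern codefinable_const simp: assms(1))
  moreover have "(\<forall>i\<in>I. V i (map ((!) B) (idx i))) \<and>
      (\<forall>J\<in>Pow I. (\<exists>x. length x = n \<and> (\<forall>i\<in>I. Q i (x @ map ((!) B) (idx i)) \<longleftrightarrow> i \<in> J)) \<longleftrightarrow>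
         (\<exists>x. length x = n \<and> (\<forall>i\<in>I. x \<in> X i \<longleftrightarrow> i \<in> J)))"
    by (auto simp: idx(2) *(2,4) cong: conj_cong)
  ultimately obtain c where c: "length c = length B" "\<forall>i\<in>I. h (X' c i) = f i"
    "\<And>J. J \<subseteq> I \<Longrightarrow> (\<exists>x. length x = n \<and> (\<forall>i\<in>I. x \<in> X' c i \<longleftrightarrow> i \<in> J)) \<longleftrightarrow>
       (\<exists>x. length x = n \<and> (\<forall>i\<in>I. x \<in> X i \<longleftrightarrow> i \<in> J))"
    using codefinable_reflect[OF model _ refl] by (smt (verit) PowI)
  show ?thesis
    unfolding reflects_def
  proof (intro exI[of _ "X' c"] conjI ballI allI impI)
    show "definable L M n (X' c i)" if "i \<in> I" for i
      unfolding X'_def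
      using definable_over_if_codefinable[of L M N n "map ((!) c) (idx i)" "P i" "Q i" UNIV]
        *(1)[OF that] len[OF that] by simp
    show "h (X' c i) = f i" if "i \<in> I" for i
      using c(2) that by blast
    show "\<exists>x. length x = n \<and> (\<forall>i\<in>I. x \<in> X i \<longleftrightarrow> x' \<in> X' c i)" if "length x' = n" for x'
      using c(3)[of "{i \<in> I. x' \<in> X' c i}"] that by auto
    show "\<exists>x'. length x' = n \<and> (\<forall>i\<in>I. x \<in> X i \<longleftrightarrow> x' \<in> X' c i)" if "length x = n" for x
      using c(3)[of "{i \<in> I. x \<in> X i}"] that by auto
  qed
qed

text \<open>Two copies of one set are reflected by two sets of \<open>M\<close> that have the same elements.\<close>

lemma transferred_value_unique:
  assumes "transferred_value n X f" "transferred_value n X g"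
  shows "f = g"
proof -
  have "\<exists>X'. reflects n UNIV (\<lambda>_. X) (\<lambda>i. if i then f else g) X'"
    by (rule reflect_transferred_values) (use assms in auto)
  then obtain X' where X': "reflects n UNIV (\<lambda>_. X) (\<lambda>i. if i then f else g) X'"
    by blast
  have "X' i \<subseteq> X' k" for i k
  proof
    fix x'
    assume x': "x' \<in> X' i"
    obtain x where "\<forall>i\<in>UNIV. x \<in> X \<longleftrightarrow> x' \<in> X' i"
      by (rule reflects_memberD[OF X' UNIV_I x'])
    with x' show "x' \<in> X' k"
      by simp
  qed
  then have "X' True = X' False"
    by (intro equalityI)
  then show ?thesis
    using reflectsD(2)[OF X', of True] reflectsD(2)[OF X', of False] by simp
qed

definition hN :: "nat \<Rightarrow> 'u list set \<Rightarrow> 's" where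
  "hN n X = (THE f. transferred_value n X f)"

lemma hN_eq: "transferred_value n X f \<Longrightarrow> hN n X = f"
  unfolding hN_def using transferred_value_unique by blast

lemma hN_uniform:
  assumes "codefinable L M N (n + length b) P Q"
  obtains V where "V b"
    "codefinable L M N (length b)
      (\<lambda>c. h {x. length x = n \<and> P (x @ c)} = hN n {x. length x = n \<and> Q (x @ b)}) V"
    "\<forall>c. length c = length b \<and> V c \<longrightarrow>
      hN n {x. length x = n \<and> Q (x @ c)} = hN n {x. length x = n \<and> Q (x @ b)}"
proof -
  obtain f V where V: "codefinable L M N (length b) (\<lambda>c. h {x. length x = n \<and> P (x @ c)} = f) V" "V b"
    by (rule value_exists[OF assms refl])
  have f: "hN n {x. length x = n \<and> Q (x @ c)} = f" if "length c = length b" "V c" for c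
  proof (rule hN_eq)
    have "representation n {x. length x = n \<and> Q (x @ c)} f c P Q V"
      using assms V(1) that unfolding representation_def by simp
    then show "transferred_value n {x. length x = n \<and> Q (x @ c)} f"
      unfolding transferred_value_def by blast
  qed
  show ?thesis
    using that[of V] V f f[OF refl V(2)] by simp
qed

lemma transferred_value_hN:
  assumes "definable L N n X"
  shows "transferred_value n X (hN n X)"
proof -
  obtain \<phi> b where "formula_in L (n + length b) \<phi>" and X: "X = solutions N n \<phi> b"
    using assms unfolding definable_over_def by blast
  then have c: "codefinable L M N (n + length b) (\<lambda>z. sat_list M z \<phi>) (\<lambda>z. sat_list N z \<phi>)"
    by (simp add: codefinable_formula)
  obtain f V where "codefinable L M N (length b) (\<lambda>c. h {x. length x = n \<and> sat_list M (x @ c) \<phi>} = f) V" "V b"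
    by (rule value_exists[OF c refl])
  with c have "representation n X f b (\<lambda>z. sat_list M z \<phi>) (\<lambda>z. sat_list N z \<phi>) V"
    unfolding representation_def X solutions_def by simp
  then have "transferred_value n X f"
    unfolding transferred_value_def by blast
  then show ?thesis
    using hN_eq by simp
qed

lemma reflect_family:
  assumes "finite I" "\<And>i. i \<in> I \<Longrightarrow> definable L N n (X i)"
  obtains X' where "reflects n I X (\<lambda>i. hN n (X i)) X'"
proof -
  have "\<exists>X'. reflects n I X (\<lambda>i. hN n (X i)) X'"
    by (rule reflect_transferred_values[OF assms(1) transferred_value_hN[OF assms(2)]])
  then show ?thesis
    using that by (elim exE)
qed

lemma reflect_set:
  assumes "definable L N n X"
  obtains X' where "definable L M n X'" "h X' = hN n X" "X' = {} \<longleftrightarrow> X = {}"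
proof -
  obtain X' where X': "reflects n {()} (\<lambda>_. X) (\<lambda>_. hN n X) X'"
    by (rule reflect_family[of "{()}" n "\<lambda>_. X"]) (simp_all add: assms)
  have "X' () \<noteq> {}" if "x \<in> X" for x
  proof -
    have "length x = n"
      by (rule definable_over_length[OF assms that])
    then obtain x' where "x \<in> X \<longleftrightarrow> x' \<in> X' ()"
      using X' unfolding reflects_def by auto
    with that show ?thesis
      by blast
  qed
  moreover have "X \<noteq> {}" if "x' \<in> X' ()" for x'
    using reflects_memberD[OF X' singletonI that] that by blast
  ultimately have "X' () = {} \<longleftrightarrow> X = {}"
    by blast
  then show ?thesis
    by (rule that[OF reflectsD(1,2)[OF X', OF singletonI]])
qed

lemma hN_in_dimensions:
  assumes "definable L N n X"
  shows "sdim_of (hN n X) \<in> dimensions L M h"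
proof -
  obtain X' where "definable L M n X'" "h X' = hN n X"
    by (rule reflect_set[OF assms])
  then show ?thesis
    unfolding dimensions_def by force
qed

lemma hN_positive:
  assumes "definable L N n X" "X \<noteq> {}"
  shows "0 < hN n X"
proof -
  obtain X' where X': "definable L M n X'" "h X' = hN n X" "X' = {} \<longleftrightarrow> X = {}"
    by (rule reflect_set[OF assms(1)])
  then show ?thesis
    using h_positive[OF X'(1)] assms(2) by simp
qed

text \<open>The condition on a parameter that the value be a given one is a formula without parameters, so
  with the parameters of \<open>X\<close> added it belongs to the type over \<open>A\<close>.\<close>

lemma hN_same_type:
  assumes "formula_in L (n + length b) \<phi>" "same_type L N A b c" "definable_over L N A n X"
  shows "hN n (solutions N n \<phi> c \<inter> X) = hN n (solutions N n \<phi> b \<inter> X)"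
proof -
  obtain \<chi> a where \<chi>: "set a \<subseteq> A" "formula_in L (n + length a) \<chi>" "X = solutions N n \<chi> a"
    using assms(3) unfolding definable_over_def by blast
  let ?P = "\<lambda>S z. sat_list S (take n z @ map ((!) (drop n z)) [0..<length b]) \<phi> \<and>
    sat_list S (take n z @ map ((!) (drop n z)) [length b..<length b + length a]) \<chi>"
  have len: "length c = length b"
    using assms(2) unfolding same_type_def by simp
  have P: "codefinable L M N (n + length (b @ a)) (?P M) (?P N)"
    using codefinable_conj_parameters[OF codefinable_formula[OF assms(1)] codefinable_formula[OF \<chi>(2)]]
    by simp
  have X: "{x. length x = n \<and> ?P N (x @ d @ a)} = solutions N n \<phi> d \<inter> X" if "length d = length b" for d
    unfolding solutions_def \<chi>(3)
    using nth_initial[of d a] nth_final[of d a] that by (auto cong: conj_cong)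
  obtain V where V: "V (b @ a)"
    "codefinable L M N (length (b @ a))
      (\<lambda>c. h {x. length x = n \<and> ?P M (x @ c)} = hN n {x. length x = n \<and> ?P N (x @ b @ a)}) V"
    "\<forall>c. length c = length (b @ a) \<and> V c \<longrightarrow>
      hN n {x. length x = n \<and> ?P N (x @ c)} = hN n {x. length x = n \<and> ?P N (x @ b @ a)}"
    by (rule hN_uniform[OF P])
  have "definable_over L N A (length b) {d. length d = length b \<and> V (d @ a)}"
    by (rule definable_over_if_codefinable'[OF _ \<chi>(1)]) (use V(2) in simp)
  then have "V (c @ a)"
    using assms(2) V(1) len unfolding same_type_def by blast
  then have "hN n {x. length x = n \<and> ?P N (x @ c @ a)} = hN n {x. length x = n \<and> ?P N (x @ b @ a)}"
    by (intro V(3)[rule_format] conjI) (simp_all add: len)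
  then show ?thesis
    by (simp only: X[OF len] X[OF refl])
qed

lemma hN_elementary_embedding:
  assumes "elementary_embedding L M N j" "formula_in L (n + length b) \<phi>"
  shows "hN n (solutions N n \<phi> (map j b)) = h (solutions M n \<phi> b)"
proof -
  have "codefinable L M N (n + length (map j b)) (\<lambda>z. sat_list M z \<phi>) (\<lambda>z. sat_list N z \<phi>)"
    using assms(2) by (simp add: codefinable_formula)
  then obtain V where V: "V (map j b)" "codefinable L M N (length (map j b))
      (\<lambda>c. h {x. length x = n \<and> sat_list M (x @ c) \<phi>} =
        hN n {x. length x = n \<and> sat_list N (x @ map j b) \<phi>}) V"
    by (rule hN_uniform)
  then obtain \<theta> where "formula_in L (length b) \<theta>"
    "sat_list M b \<theta> \<longleftrightarrow> h (solutions M n \<phi> b) = hN n (solutions N n \<phi> (map j b))"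
    "sat_list N (map j b) \<theta>"
    unfolding codefinable_def solutions_def by auto
  then show ?thesis
    using assms(1) unfolding elementary_embedding_def by metis
qed

section \<open>Dimension of covers and of dividing sets\<close>

text \<open>By subadditivity the measure of \<open>Y\<close> is at most a multiple of the largest measure among the sets of
  the cover.\<close>

lemma dim_cover:
  assumes "definable L N n Y" "Y \<noteq> {}" "finite I" "\<And>i. i \<in> I \<Longrightarrow> definable L N n (Z i)"
    "Y \<subseteq> (\<Union>i\<in>I. Z i)"
  obtains i where "i \<in> I" "sdim_of (hN n Y) \<le> sdim_of (hN n (Z i))"
proof -
  \<comment> \<open>The index \<open>None\<close> stands for \<open>Y\<close>, so that the covering of \<open>Y\<close> is reflected as well.\<close>
  define W where "W i = (case i of None \<Rightarrow> Y | Some i \<Rightarrow> Z i)" for i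
  have "finite (insert None (Some ` I))"
    using assms(3) by simp
  moreover have "definable L N n (W i)" if "i \<in> insert None (Some ` I)" for i
    using that assms(1,4) by (auto simp: W_def)
  ultimately obtain W' where W': "reflects n (insert None (Some ` I)) W (\<lambda>i. hN n (W i)) W'"
    by (rule reflect_family)
  have "W' None \<subseteq> (\<Union>i\<in>I. W' (Some i))"
  proof
    fix x'
    assume x': "x' \<in> W' None"
    obtain x where "\<forall>i\<in>insert None (Some ` I). x \<in> W i \<longleftrightarrow> x' \<in> W' i"
      by (rule reflects_memberD[OF W' _ x']) simp
    then show "x' \<in> (\<Union>i\<in>I. W' (Some i))"
      using x' assms(5) by (auto simp: W_def)
  qed
  then have "h (W' None) \<le> (\<Sum>i\<in>I. h (W' (Some i)))"
    using reflectsD(1)[OF W'] assms(3) by (intro h_subadditive) auto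
  then have le: "hN n Y \<le> (\<Sum>i\<in>I. hN n (Z i))"
    using reflectsD(2)[OF W'] by (simp add: W_def)
  have "I \<noteq> {}"
    using assms(2,5) by auto
  then have "Max ((\<lambda>j. hN n (Z j)) ` I) \<in> (\<lambda>j. hN n (Z j)) ` I"
    using assms(3) by simp
  then obtain i where i: "i \<in> I" "hN n (Z i) = Max ((\<lambda>j. hN n (Z j)) ` I)"
    by force
  then have "\<forall>j\<in>I. hN n (Z j) \<le> hN n (Z i)"
    using assms(3) by simp
  then have "(\<Sum>j\<in>I. hN n (Z j)) \<le> of_nat (card I) * hN n (Z i)"
    using sum_mono[of I "\<lambda>j. hN n (Z j)" "\<lambda>_. hN n (Z i)"] by simp
  with le have "hN n Y \<le> of_nat (card I) * hN n (Z i)"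
    by simp
  moreover have "card I > 0"
    using \<open>I \<noteq> {}\<close> assms(3) by (simp add: card_gt_0_iff)
  ultimately show ?thesis
    using that[OF i(1)] by (auto simp: le_sdim_iff)
qed

text \<open>The sets \<open>Z\<^sub>i \<inter> X\<close> for a dividing sequence \<open>Z\<^sub>i\<close> have equal measure and overlap at most \<open>k - 1\<close>.
  If that measure had the dimension of \<open>X\<close>, finitely many of them would have too large a total
  measure.\<close>

lemma dividing_drops_dim:
  assumes "definable_over L N A n X" "divides_over L N A n Z" "Z \<inter> X \<noteq> {}"
  shows "sdim_of (hN n (Z \<inter> X)) < sdim_of (hN n X)"
proof (rule ccontr)
  assume "\<not> ?thesis"
  then obtain q where q: "q > 0" "hN n X \<le> of_nat q * hN n (Z \<inter> X)"
    by (auto simp: not_less le_sdim_iff)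
  obtain \<phi> b bs k where \<phi>: "formula_in L (n + length b) \<phi>" "Z = solutions N n \<phi> b" "k > 0"
    "\<And>i. same_type L N A b (bs i)" "\<And>I. card I = k \<Longrightarrow> (\<Inter>i\<in>I. solutions N n \<phi> (bs (i::nat))) = {}"
    using assms(2) unfolding divides_over_def by blast
  define f where "f = hN n (Z \<inter> X)"
  have X: "definable L N n X"
    using definable_over_mono[OF assms(1)] by simp
  have Z: "definable L N n (solutions N n \<phi> c)" if "length c = length b" for c
    using \<phi>(1) that unfolding definable_over_def by (intro exI[of _ \<phi>] exI[of _ c]) simp
  have len: "length (bs i) = length b" for i
    using \<phi>(4)[of i] unfolding same_type_def by simp
  have "0 < f"
    unfolding f_def using hN_positive[OF definable_over_Int[OF Z[OF refl] X]] assms(3) \<phi>(2) by simp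
  \<comment> \<open>The number of sets for which the two estimates of the total measure collide.\<close>
  define K where "K = Suc ((k - 1) * q)"
  \<comment> \<open>The index \<open>K\<close> stands for \<open>X\<close> itself, so that inclusion in \<open>X\<close> is reflected as well.\<close>
  define W where "W i = (if i < K then solutions N n \<phi> (bs i) \<inter> X else X)" for i
  have W: "definable L N n (W i)" for i
    using definable_over_Int[OF Z[OF len] X] X by (simp add: W_def)
  obtain W' where W': "reflects n {..K} W (\<lambda>i. hN n (W i)) W'"
    by (rule reflect_family[of "{..K}" n W]) (simp_all add: W)
  have "(\<Sum>i<K. h (W' i)) \<le> of_nat (k - 1) * h (W' K)"
  proof (rule h_bounded_overlap)
    show "W' i \<subseteq> W' K" if "i \<in> {..<K}" for i
    proof
      fix x'
      assume x': "x' \<in> W' i"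
      have i: "i \<in> {..K}"
        using that by simp
      obtain x where x: "\<forall>i\<in>{..K}. x \<in> W i \<longleftrightarrow> x' \<in> W' i"
        by (rule reflects_memberD[OF W' i x'])
      then have "x \<in> W i"
        using i x' by blast
      then have "x \<in> W K"
        using that by (simp add: W_def)
      then show "x' \<in> W' K"
        using x by blast
    qed
    show "card {i \<in> {..<K}. x' \<in> W' i} \<le> k - 1" if x': "x' \<in> W' K" for x'
    proof (rule ccontr)
      assume "\<not> ?thesis"
      then have "k \<le> card {i \<in> {..<K}. x' \<in> W' i}"
        by simp
      then obtain I where I: "I \<subseteq> {i \<in> {..<K}. x' \<in> W' i}" "card I = k"
        by (rule obtain_subset_with_card_n)
      obtain x where "\<forall>i\<in>{..K}. x \<in> W i \<longleftrightarrow> x' \<in> W' i"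
        by (rule reflects_memberD[OF W' _ x']) simp
      then have "x \<in> solutions N n \<phi> (bs i)" if "i \<in> I" for i
        using I(1) that by (fastforce simp: W_def split: if_splits)
      then show False
        using \<phi>(5)[OF I(2)] by blast
    qed
  qed (use reflectsD(1)[OF W'] in auto)
  moreover have "h (W' i) = f" if "i < K" for i
    using reflectsD(2)[OF W', of i] that hN_same_type[OF \<phi>(1) \<phi>(4) assms(1)] by (simp add: W_def f_def \<phi>(2))
  ultimately have "of_nat K * f \<le> of_nat (k - 1) * hN n X"
    using reflectsD(2)[OF W', of K] by (simp add: W_def)
  also have "\<dots> \<le> of_nat (k - 1) * (of_nat q * f)"
    using q(2) unfolding f_def by (rule arch_mult_left_mono)
  also have "\<dots> = of_nat ((k - 1) * q) * f"
    by (simp add: mult.assoc)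
  also have "\<dots> < of_nat K * f"
    unfolding K_def by (rule multiples_strict_mono[OF \<open>0 < f\<close>])
  finally show False
    by simp
qed

end

section \<open>Ordinals given by elements of well-orders\<close>

lemma Well_order_ordinal_at: "Well_order r \<Longrightarrow> Well_order (ordinal_at r \<alpha>)"
  unfolding ordinal_at_def by (rule Well_order_Restr)

lemma underS_ordinal_at:
  assumes "Well_order r" "\<beta> \<in> underS r \<alpha>"
  shows "underS (ordinal_at r \<alpha>) \<beta> = underS r \<beta>"
proof -
  have "trans r"
    using assms(1) by (simp add: order_on_defs)
  moreover have "antisym r"
    using assms(1) by (simp add: order_on_defs)
  ultimately show ?thesis
    using assms(2) unfolding ordinal_at_def underS_def by (auto dest: transD antisymD)
qed

lemma underS_trans:
  assumes "Well_order r" "\<gamma> \<in> underS r \<beta>" "\<beta> \<in> underS r \<alpha>"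
  shows "\<gamma> \<in> underS r \<alpha>"
  using assms unfolding underS_def order_on_defs by (auto dest: transD antisymD)

lemma ordinal_at_ordinal_at:
  assumes "Well_order r" "\<beta> \<in> underS r \<alpha>"
  shows "ordinal_at (ordinal_at r \<alpha>) \<beta> = ordinal_at r \<beta>"
  unfolding ordinal_at_def[of _ \<beta>] underS_ordinal_at[OF assms]
  using underS_trans[OF assms(1) _ assms(2)] by (auto simp: ordinal_at_def)

lemma Field_ordinal_at:
  assumes "Well_order r"
  shows "Field (ordinal_at r \<alpha>) = underS r \<alpha>"
  using assms wo_rel.underS_ofilter[of r \<alpha>]
  unfolding ordinal_at_def wo_rel_def by (intro Field_Restr_ofilter) auto

lemma ordinal_at_strict_mono:
  assumes "Well_order r" "\<beta> \<in> underS r \<alpha>"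
  shows "(ordinal_at r \<beta>, ordinal_at r \<alpha>) \<in> ordLess"
proof -
  have "(ordinal_at (ordinal_at r \<alpha>) \<beta>, ordinal_at r \<alpha>) \<in> ordLess"
    unfolding ordinal_at_def[of _ \<beta>]
    by (rule underS_Restr_ordLess[OF Well_order_ordinal_at[OF assms(1)]])
      (use assms(2) Field_ordinal_at[OF assms(1)] in auto)
  then show ?thesis
    by (simp only: ordinal_at_ordinal_at[OF assms])
qed

text \<open>An ordinal is at most \<open>s\<close> iff all smaller ordinals are less than \<open>s\<close>. In this form the zero,
  successor and limit cases of a rank computation are treated alike.\<close>

lemma ordinal_at_leI:
  assumes "Well_order r" "Well_order s" "\<And>\<beta>. \<beta> \<in> underS r \<alpha> \<Longrightarrow> (ordinal_at r \<beta>, s) \<in> ordLess"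
  shows "(ordinal_at r \<alpha>, s) \<in> ordLeq"
  unfolding ordLeq_iff_ordLess_Restr[OF Well_order_ordinal_at[OF assms(1)] assms(2)]
    Field_ordinal_at[OF assms(1)] ordinal_at_def[symmetric]
  using ordinal_at_ordinal_at[OF assms(1)] assms(3) by simp

section \<open>D-rank, forking and supersimplicity\<close>

context measured_theory_model
begin

context
  fixes D0 :: "'s sdim rel"
  assumes D0: "D0 = {(x, y). x \<in> dimensions L M h \<and> y \<in> dimensions L M h \<and> x \<le> y}"
    and wo: "well_order_on (dimensions L M h) D0"
begin

lemma Well_order_D0: "Well_order D0"
  using wo well_order_on_Well_order by blast

lemma dim_less_underS:
  assumes "definable L N n X" "definable L N n Y" "sdim_of (hN n Y) < sdim_of (hN n X)"
  shows "sdim_of (hN n Y) \<in> underS D0 (sdim_of (hN n X))"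
  using assms(3) hN_in_dimensions[OF assms(1)] hN_in_dimensions[OF assms(2)]
  unfolding D0 underS_def by auto

lemma D_rank_nonempty: "D_rank_ge L N r \<alpha> n X \<Longrightarrow> X \<noteq> {}"
  by (induction rule: D_rank_ge.induct) auto

text \<open>At a successor the witness \<open>Y\<close> divides and is nonempty, so that its dimension is strictly below
  that of \<open>X\<close>. At a limit every smaller element lies strictly below another smaller one, which turns
  the weak inequalities of the induction hypothesis into strict ones.\<close>

lemma D_rank_le_dim:
  assumes "D_rank_ge L N r \<alpha> n X" "Well_order r" "definable L N n X"
  shows "(ordinal_at r \<alpha>, ordinal_at D0 (sdim_of (hN n X))) \<in> ordLeq"
  using assms(1,3)
proof (induction rule: D_rank_ge.induct)
  case (zero \<alpha> X n)
  show ?case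
    by (rule ordinal_at_leI[OF assms(2) Well_order_ordinal_at[OF Well_order_D0]])
      (use zero.hyps in auto)
next
  case (succ \<beta> \<alpha> A n X Y)
  have "Y \<inter> X = Y"
    using succ.hyps by blast
  then have "sdim_of (hN n Y) < sdim_of (hN n X)"
    using dividing_drops_dim[of A n X Y] succ.hyps D_rank_nonempty[of r \<beta> n Y] by simp
  then have less: "(ordinal_at D0 (sdim_of (hN n Y)), ordinal_at D0 (sdim_of (hN n X))) \<in> ordLess"
    by (intro ordinal_at_strict_mono[OF Well_order_D0] dim_less_underS succ.prems succ.hyps)
  show ?case
  proof (rule ordinal_at_leI[OF assms(2) Well_order_ordinal_at[OF Well_order_D0]])
    fix \<gamma>
    assume "\<gamma> \<in> underS r \<alpha>"
    \<comment> \<open>Here \<open>\<alpha>\<close> is the successor of \<open>\<beta>\<close>.\<close>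
    then have "\<gamma> = \<beta> \<or> \<gamma> \<in> underS r \<beta>"
      using succ.hyps(2) unfolding under_def underS_def by auto
    then have "(ordinal_at r \<gamma>, ordinal_at r \<beta>) \<in> ordLeq"
      using ordinal_at_strict_mono[OF assms(2)] ordLess_imp_ordLeq
        ordLeq_reflexive[OF Well_order_ordinal_at[OF assms(2)]] by blast
    then show "(ordinal_at r \<gamma>, ordinal_at D0 (sdim_of (hN n X))) \<in> ordLess"
      using succ.IH[OF succ.hyps(5)] less ordLeq_transitive ordLeq_ordLess_trans by blast
  qed
next
  case (limit \<alpha> n X)
  show ?case
  proof (rule ordinal_at_leI[OF assms(2) Well_order_ordinal_at[OF Well_order_D0]])
    fix \<beta>
    assume \<beta>: "\<beta> \<in> underS r \<alpha>"
    have "under r \<beta> \<subseteq> underS r \<alpha>"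
      using \<beta> assms(2) unfolding under_def underS_def order_on_defs by (auto dest: transD antisymD)
    then obtain \<gamma> where \<gamma>: "\<gamma> \<in> underS r \<alpha>" "(\<gamma>, \<beta>) \<notin> r"
      using limit.hyps(2) \<beta> unfolding under_def by blast
    have "\<beta> \<in> underS r \<gamma>"
      using \<beta> \<gamma> assms(2) unfolding order_on_defs total_on_def underS_def
      by (metis (mono_tags, lifting) FieldI1 mem_Collect_eq refl_onD)
    then show "(ordinal_at r \<beta>, ordinal_at D0 (sdim_of (hN n X))) \<in> ordLess"
      using ordinal_at_strict_mono[OF assms(2)] limit.IH[OF \<gamma>(1) limit.prems] ordLess_ordLeq_trans
      by blast
  qed
qed

text \<open>A finite set \<open>A\<close> of parameters for a set of least dimension among the \<open>B\<close>-definable sets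
  containing \<open>a\<close> works: the dividing sets over \<open>A\<close> cut this set in smaller dimension, and finitely
  many sets of smaller dimension cannot cover a set of the least dimension.\<close>

lemma type_nonforking_base:
  "\<exists>A. finite A \<and> A \<subseteq> B \<and> \<not> type_forks_over L N A a B"
proof -
  let ?n = "length a"
  define S where "S = {sdim_of (hN ?n X) | X. definable_over L N B ?n X \<and> a \<in> X}"
  have "{x. length x = ?n} \<in> {X. definable_over L N B ?n X \<and> a \<in> X}"
    using definable_over_tuples by blast
  then have "S \<noteq> {}"
    unfolding S_def by blast
  moreover have "S \<subseteq> dimensions L M h"
    using hN_in_dimensions definable_over_mono[of L N B _ _ UNIV] unfolding S_def by blast
  moreover have "wf (D0 - Id)"
    using wo unfolding well_order_on_def by blast
  ultimately obtain s where s: "s \<in> S" "\<And>t. t \<in> S \<Longrightarrow> s \<le> t"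
    unfolding wf_eq_minimal D0 by (smt (verit) DiffI case_prodI ex_in_conv linorder_le_cases mem_Collect_eq pair_in_Id_conv subsetD)
  then obtain X where X: "definable_over L N B ?n X" "a \<in> X" "s = sdim_of (hN ?n X)"
    unfolding S_def by blast
  obtain A where A: "finite A" "A \<subseteq> B" "definable_over L N A ?n X"
    using definable_over_finite[OF X(1)] by blast
  have "\<not> type_forks_over L N A a B"
  proof
    assume "type_forks_over L N A a B"
    then obtain Y F where Y: "definable_over L N B ?n Y" "a \<in> Y"
      and F: "finite F" "\<forall>Z\<in>F. divides_over L N A ?n Z" "Y \<subseteq> \<Union> F"
      unfolding type_forks_over_def forks_over_def by blast
    have XY: "definable_over L N B ?n (Y \<inter> X)"
      by (rule definable_over_Int[OF Y(1) X(1)])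
    have X': "definable L N ?n X"
      using definable_over_mono[OF X(1)] by simp
    have Z: "definable L N ?n (Z \<inter> X)" if "Z \<in> F" for Z
    proof -
      have "definable L N ?n Z"
        using F(2) that unfolding divides_over_def definable_over_def by blast
      then show ?thesis
        using definable_over_Int X' by blast
    qed
    have "sdim_of (hN ?n X) \<le> sdim_of (hN ?n (Y \<inter> X))"
      using s(2) XY X(2,3) Y(2) unfolding S_def by blast
    moreover obtain Z where "Z \<in> {Z \<in> F. Z \<inter> X \<noteq> {}}"
      "sdim_of (hN ?n (Y \<inter> X)) \<le> sdim_of (hN ?n (Z \<inter> X))"
    proof (rule dim_cover[of ?n "Y \<inter> X" "{Z \<in> F. Z \<inter> X \<noteq> {}}" "\<lambda>Z. Z \<inter> X"])
      show "definable L N ?n (Y \<inter> X)"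
        using definable_over_mono[OF XY] by simp
      show "Y \<inter> X \<subseteq> (\<Union>Z\<in>{Z \<in> F. Z \<inter> X \<noteq> {}}. Z \<inter> X)"
        using F(3) by blast
    qed (use F Y(2) X(2) Z in auto)
    moreover from this have "sdim_of (hN ?n (Z \<inter> X)) < sdim_of (hN ?n X)"
      using dividing_drops_dim[OF A(3)] F(2) by blast
    ultimately show False
      by simp
  qed
  with A show ?thesis
    by blast
qed

end

end

lemma elementary_embedding_models:
  assumes "elementary_embedding L M N j"
  shows "models N (Th L M)"
  unfolding models_def
proof
  fix \<sigma>
  assume "\<sigma> \<in> Th L M"
  then have "formula_in L (length []) \<sigma>" "sat_list M [] \<sigma>"
    unfolding Th_def by simp_all
  then have "sat_list N (map j []) \<sigma>"
    using assms unfolding elementary_embedding_def by blast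
  then show "sat_list N [] \<sigma>"
    by simp
qed

theorem theorem6p1p4:
  fixes L :: "('f, 'r) language"
    and M :: "('f, 'r, 'a) fo_structure"
    and h :: "'a list set \<Rightarrow> 's::measuring_semiring"
    and D0 :: "'s sdim rel"
  assumes "S_measurable_by L M h"
    and "D0 = {(x, y). x \<in> dimensions L M h \<and> y \<in> dimensions L M h \<and> x \<le> y}"
    and "well_order_on (dimensions L M h) D0"
  shows "(\<forall>(N :: ('f, 'r, 'u) fo_structure) j n \<phi> b.
            sufficiently_saturated L N \<and> elementary_embedding L M N j \<and>
            formula_in L (n + length b) \<phi> \<longrightarrow>
              D_rank_le TYPE('o) L N n (solutions N n \<phi> (map j b))
                (ordinal_at D0 (sdim_of (h (solutions M n \<phi> b))))) \<and>
         supersimple TYPE('u) L (Th L M)"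
proof (intro conjI allI impI)
  fix N :: "('f, 'r, 'u) fo_structure" and j :: "'a \<Rightarrow> 'u" and n \<phi> and b :: "'a list"
  assume *: "sufficiently_saturated L N \<and> elementary_embedding L M N j \<and> formula_in L (n + length b) \<phi>"
  interpret measured_theory_model L M h N
    by unfold_locales (use assms(1) elementary_embedding_models * in auto)
  have "definable L N n (solutions N n \<phi> (map j b))"
    using * unfolding definable_over_def by (intro exI[of _ \<phi>] exI[of _ "map j b"]) simp
  moreover have "hN n (solutions N n \<phi> (map j b)) = h (solutions M n \<phi> b)"
    using hN_elementary_embedding * by blast
  ultimately show "D_rank_le TYPE('o) L N n (solutions N n \<phi> (map j b))
      (ordinal_at D0 (sdim_of (h (solutions M n \<phi> b))))"
    unfolding D_rank_le_def using D_rank_le_dim[OF assms(2,3)] by metis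
next
  show "supersimple TYPE('u) L (Th L M)"
    unfolding supersimple_def
  proof (intro allI impI)
    fix N :: "('f, 'r, 'u) fo_structure" and a B
    assume *: "models N (Th L M) \<and> sufficiently_saturated L N"
    interpret measured_theory_model L M h N
      by unfold_locales (use assms(1) * in auto)
    show "\<exists>A. finite A \<and> A \<subseteq> B \<and> \<not> type_forks_over L N A a B"
      by (rule type_nonforking_base[OF assms(2,3)])
  qed
qed

end
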